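(* Assume the standing setting and assumptions given in the context, and let $N\in\mathbb{N}$ with $N\ge 1$ be arbitrary. Then: (i) For each $x\in\mathbb{R}^n$ the optimization problem $\mathfrak{P}_T(x)$ is a convex quadratic programming problem, and it is feasible for all $x\in\mathcal{C}_T$. (ii) The value function $V_T^0:\mathcal{C}_T\to\mathbb{R}$ is a convex, continuous and piecewise quadratic function such that $V_T^0(x)=0$ for all $x\in\mathcal{S}$, and $0<V_T^0(x)<\infty$ for all $x\in\mathcal{C}_T\setminus\mathcal{S}$. (iii) The components $\mathbf{z}_{N-1}^0:\mathcal{C}_T\to\mathbb{R}^{Nn}$, $\mathbf{v}_{N-1}^0:\mathcal{C}_T\to\mathbb{R}^{Nm}$ and $\mathbf{z}_{[N:N+N_{\mathcal{Z}}]}^0:\mathcal{C}_T\to\mathbb{R}^{(N_{\mathcal{Z}}+1)n}$ of the optimizer map $\mathbf{d}_T^0$ are (single-valued) continuous and piecewise affine functions. (iv) There exists a continuous and piecewise affine function $\boldsymbol{\omega}_{N_{\mathcal{S}}-1}^*:\mathcal{C}_T\to\mathbb{R}^{N_{\mathcal{S}}n}$ such that, for all $x\in\mathcal{C}_T$, $(\mathbf{z}_{N-1}^0(x),\mathbf{v}_{N-1}^0(x),\mathbf{z}_{[N:N+N_{\mathcal{Z}}]}^0(x),\boldsymbol{\omega}_{N_{\mathcal{S}}-1}^*(x))\in\mathbf{d}_T^0(x)$.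
   Context: Notation. $\mathbb{N}$ is the set of non-negative integers; $\mathbb{N}_b=\{0,1,\dots,b\}$ for $b\in\mathbb{N}$, and $\mathbb{N}_{-1}=\emptyset$. Empty sums are $0$. $\rho(M)$ is the spectral radius; a square matrix $M$ is strictly stable iff $\rho(M)<1$. $\bigoplus$ and $\oplus$ denote Minkowski sums (a point is identified with a singleton). For a set $\mathcal{X}$, matrix $M$ and $k\in\mathbb{N}$, $M^k\mathcal{X}=\{M^kx: x\in\mathcal{X}\}$ and $M^{-k}\mathcal{X}=\{y: M^ky\in\mathcal{X}\}$ (preimage; $M$ need not be invertible). A proper $D$-set is a closed convex set containing the origin in its interior; a proper $C$-set is a bounded proper $D$-set. A polyhedral set is an intersection of finitely many closed half-spaces; a polytopic set is a bounded polyhedral set. The support function is $h(\mathcal{X},y)=\sup\{y^\top x: x\in\mathcal{X}\}$. A function on a polyhedral set is piecewise affine (quadratic) if its domain is a union of finitely many polyhedral sets on each of which the function is affine (quadratic). Setting and assumptions. - $A\in\mathbb{R}^{n\times n}$, $B\in\mathbb{R}^{n\times m}$, and $(A,B)$ is strictly stabilizable (some $K$ makes $A+BK$ strictly stable). - $\mathcal{Y}=\{(x,u)\in\mathbb{R}^n\times\mathbb{R}^m: c_i^\top x+d_i^\top u\le 1\ \forall i\in\mathcal{I}_{\mathcal{Y}}\}$, $\mathcal{I}_{\mathcal{Y}}=\{1,\dots,p\}$, is a polyhedral proper $D$-set and this representation is irreducible (no inequality is redundant). - $\mathcal{W}=\{w\in\mathbb{R}^n: e_i^\top w\le 1\ \forall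 i\in\mathcal{I}_{\mathcal{W}}\}$, $\mathcal{I}_{\mathcal{W}}=\{1,\dots,q\}$, is a polytopic proper $C$-set and this representation is irreducible. - $Q\in\mathbb{R}^{n\times n}$ and $R\in\mathbb{R}^{m\times m}$ are symmetric positive definite. - $K_{\mathcal{S}}\in\mathbb{R}^{m\times n}$ is such that $A+BK_{\mathcal{S}}$ is strictly stable. - $\mathcal{S}=(1-\alpha)^{-1}\bigoplus_{j=0}^{N_{\mathcal{S}}-1}(A+BK_{\mathcal{S}})^j\mathcal{W}$, where $\alpha\in[0,1)$ and $N_{\mathcal{S}}\in\mathbb{N}$ satisfy $(A+BK_{\mathcal{S}})^{N_{\mathcal{S}}}\mathcal{W}\subseteq\alpha\mathcal{W}$. - With $f_i:=h(\mathcal{S},c_i+K_{\mathcal{S}}^\top d_i)$, one has $f_i<1$ for all $i\in\mathcal{I}_{\mathcal{Y}}$. - $\mathcal{Y}_{\mathcal{S}}=\{(z,v): (z+s,v+K_{\mathcal{S}}s)\in\mathcal{Y}\ \forall s\in\mathcal{S}\}$. - $K_{\mathcal{Z}}\in\mathbb{R}^{m\times n}$ is such that $A+BK_{\mathcal{Z}}$ is strictly stable; $\mathcal{Z}_{\mathcal{S}}=\{z: (z,K_{\mathcal{Z}}z)\in\mathcal{Y}_{\mathcal{S}}\}$. - $\mathcal{Z}_f=\bigcap_{j=0}^{N_{\mathcal{Z}}}(A+BK_{\mathcal{Z}})^{-j}\mathcal{Z}_{\mathcal{S}}$, where $N_{\mathcal{Z}}\in\mathbb{N}$ satisfies $\bigcap_{j=0}^{N_{\mathcal{Z}}}(A+BK_{\mathcal{Z}})^{-j}\mathcal{Z}_{\mathcal{S}}\subseteq(A+BK_{\mathcal{Z}})^{-(N_{\mathcal{Z}}+1)}\mathcal{Z}_{\mathcal{S}}$.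 - $P\in\mathbb{R}^{n\times n}$ is symmetric positive definite with $(A+BK_{\mathcal{Z}})^\top P(A+BK_{\mathcal{Z}})-P\preceq-(Q+K_{\mathcal{Z}}^\top RK_{\mathcal{Z}})$. Put $Q_{\mathcal{Z}}:=Q+K_{\mathcal{Z}}^\top RK_{\mathcal{Z}}$. Problem $\mathfrak{P}_T(x)$. $T=(N,N_{\mathcal{S}},N_{\mathcal{Z}})$. The decision variable is $\mathbf{d}_T=(\mathbf{z}_{N-1},\mathbf{v}_{N-1},\mathbf{z}_{[N:N+N_{\mathcal{Z}}]},\boldsymbol{\omega}_{N_{\mathcal{S}}-1})$ with $\mathbf{z}_{N-1}=\{z_k\}_{k=0}^{N-1}$, $\mathbf{v}_{N-1}=\{v_k\}_{k=0}^{N-1}$, $\mathbf{z}_{[N:N+N_{\mathcal{Z}}]}=\{z_k\}_{k=N}^{N+N_{\mathcal{Z}}}$, $\boldsymbol{\omega}_{N_{\mathcal{S}}-1}=\{\omega_k\}_{k=0}^{N_{\mathcal{S}}-1}$, where $z_k,\omega_k\in\mathbb{R}^n$, $v_k\in\mathbb{R}^m$. The cost is $$V_T(\mathbf{d}_T)=\sum_{k=0}^{N-1}(z_k^\top Qz_k+v_k^\top Rv_k)+\sum_{k=N}^{N+N_{\mathcal{Z}}-1}z_k^\top Q_{\mathcal{Z}}z_k+z_{N+N_{\mathcal{Z}}}^\top Pz_{N+N_{\mathcal{Z}}}.$$ For $x\in\mathbb{R}^n$, $\mathfrak{P}_T(x)$ is: minimize $V_T(\mathbf{d}_T)$ over $\mathbf{d}_T$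 subject to (a) $x=z_0+(1-\alpha)^{-1}\sum_{j=0}^{N_{\mathcal{S}}-1}(A+BK_{\mathcal{S}})^j\omega_j$; (b) $e_i^\top\omega_j\le1$ for all $j\in\mathbb{N}_{N_{\mathcal{S}}-1}$, $i\in\mathcal{I}_{\mathcal{W}}$; (c) $z_{k+1}=Az_k+Bv_k$ for all $k\in\mathbb{N}_{N-1}$; (d) $c_i^\top z_k+d_i^\top v_k\le1-f_i$ for all $k\in\mathbb{N}_{N-1}$, $i\in\mathcal{I}_{\mathcal{Y}}$; (e) $z_{N+k+1}=(A+BK_{\mathcal{Z}})z_{N+k}$ for all $k\in\mathbb{N}_{N_{\mathcal{Z}}-1}$; (f) $(c_i^\top+d_i^\top K_{\mathcal{Z}})z_{N+k}\le1-f_i$ for all $k\in\mathbb{N}_{N_{\mathcal{Z}}}$, $i\in\mathcal{I}_{\mathcal{Y}}$. $\mathcal{C}_T$ (the $T$-controllable set) is the set of $x$ for which (a)-(f) are feasible. For $x\in\mathcal{C}_T$, $V_T^0(x)$ is the optimal value and $\mathbf{d}_T^0(x)$ is the set of minimizers of $\mathfrak{P}_T(x)$; $\mathbf{z}_{N-1}^0(x)=\{z_k^0(x)\}_{k=0}^{N-1}$, $\mathbf{v}_{N-1}^0(x)=\{v_k^0(x)\}_{k=0}^{N-1}$, $\mathbf{z}_{[N:N+N_{\mathcal{Z}}]}^0(x)$ denote the corresponding components of the minimizers. *)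

theory Defs
  imports
    "HOL-Analysis.Analysis"
    "HOL-Library.Function_Algebras"
    "HOL-Library.Set_Algebras"
begin

text \<open>
  Finite sequences of vectors whose length is a number (and not a type) are functions on
  \<^typ>\<open>nat\<close> that vanish outside their index range. The pointwise vector space structure
  below makes \<^const>\<open>linear\<close>, \<^const>\<open>bilinear\<close>, \<^const>\<open>subspace\<close> and \<^const>\<open>convex_on\<close> available
  for them; their topology is the product topology of \<^theory>\<open>HOL-Analysis.Function_Topology\<close>,
  which on sequences supported in a fixed finite range is the Euclidean one.
\<close>

instantiation "fun" :: (type, real_vector) real_vector
begin

definition scaleR_fun_def: "r *\<^sub>R f = (\<lambda>x. r *\<^sub>R f x)"

instance
  by standard (simp_all add: scaleR_fun_def fun_eq_iff scaleR_add_right scaleR_add_left)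

end

subsection \<open>Matrices\<close>

text \<open>The power operation of the type class hierarchy is componentwise on
  \<^typ>\<open>real^'n^'n\<close>, hence a separate matrix power.\<close>

definition matpow :: "real^'n^'n \<Rightarrow> nat \<Rightarrow> real^'n^'n" where
  "matpow M k = (((**) M) ^^ k) (mat 1)"

definition complex_eigenvalue :: "real^'n^'n \<Rightarrow> complex \<Rightarrow> bool" where
  "complex_eigenvalue M l \<longleftrightarrow>
     (\<exists>v::complex^'n. v \<noteq> 0 \<and> (\<chi> i j. complex_of_real (M $ i $ j)) *v v = l *s v)"

definition spectral_radius :: "real^'n^'n \<Rightarrow> real" where
  "spectral_radius M = Max (cmod ` {l. complex_eigenvalue M l})"

definition strictly_stable :: "real^'n^'n \<Rightarrow> bool" where
  "strictly_stable M \<longleftrightarrow> spectral_radius M < 1"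

definition strictly_stabilizable :: "real^'n^'n \<Rightarrow> real^'m^'n \<Rightarrow> bool" where
  "strictly_stabilizable A B \<longleftrightarrow> (\<exists>K. strictly_stable (A + B ** K))"

definition pos_definite :: "real^'n^'n \<Rightarrow> bool" where
  "pos_definite M \<longleftrightarrow> transpose M = M \<and> (\<forall>x. x \<noteq> 0 \<longrightarrow> 0 < x \<bullet> (M *v x))"

definition pos_semidefinite :: "real^'n^'n \<Rightarrow> bool" where
  "pos_semidefinite M \<longleftrightarrow> transpose M = M \<and> (\<forall>x. 0 \<le> x \<bullet> (M *v x))"

definition loewner_le :: "real^'n^'n \<Rightarrow> real^'n^'n \<Rightarrow> bool" where
  "loewner_le M M' \<longleftrightarrow> pos_semidefinite (M' - M)"

subsection \<open>Sets\<close>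

definition proper_D_set :: "'a::euclidean_space set \<Rightarrow> bool" where
  "proper_D_set X \<longleftrightarrow> closed X \<and> convex X \<and> 0 \<in> interior X"

definition proper_C_set :: "'a::euclidean_space set \<Rightarrow> bool" where
  "proper_C_set X \<longleftrightarrow> proper_D_set X \<and> bounded X"

definition irreducible_representation :: "'i set \<Rightarrow> ('i \<Rightarrow> 'a set) \<Rightarrow> bool" where
  "irreducible_representation I H \<longleftrightarrow> (\<forall>i\<in>I. (\<Inter>j\<in>I - {i}. H j) \<noteq> (\<Inter>j\<in>I. H j))"

text \<open>The supremum is a real one, so this is meaningful only if it is finite
  (e.g. for nonempty bounded \<open>X\<close>).\<close>

definition support_fun :: "'a::euclidean_space set \<Rightarrow> 'a \<Rightarrow> real" where
  "support_fun X y = (SUP x\<in>X. y \<bullet> x)"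

subsection \<open>Piecewise affine and piecewise quadratic functions\<close>

definition affine_map :: "('a::real_vector \<Rightarrow> 'b::real_vector) \<Rightarrow> bool" where
  "affine_map g \<longleftrightarrow> (\<exists>L b. linear L \<and> g = (\<lambda>x. L x + b))"

definition quadratic_map :: "('a::real_vector \<Rightarrow> real) \<Rightarrow> bool" where
  "quadratic_map g \<longleftrightarrow> (\<exists>H L b. bilinear H \<and> linear L \<and> g = (\<lambda>x. H x x + L x + b))"

definition piecewise_on ::
    "(('a::euclidean_space \<Rightarrow> 'b) \<Rightarrow> bool) \<Rightarrow> 'a set \<Rightarrow> ('a \<Rightarrow> 'b) \<Rightarrow> bool" where
  "piecewise_on \<Phi> D g \<longleftrightarrow> polyhedron D \<and>
     (\<exists>\<P>. finite \<P> \<and> (\<forall>X\<in>\<P>. polyhedron X) \<and> D = \<Union>\<P> \<and>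
        (\<forall>X\<in>\<P>. \<exists>g'. \<Phi> g' \<and> (\<forall>x\<in>X. g x = g' x)))"

abbreviation piecewise_affine_on ::
    "'a::euclidean_space set \<Rightarrow> ('a \<Rightarrow> 'b::real_vector) \<Rightarrow> bool" where
  "piecewise_affine_on \<equiv> piecewise_on affine_map"

abbreviation piecewise_quadratic_on ::
    "'a::euclidean_space set \<Rightarrow> ('a \<Rightarrow> real) \<Rightarrow> bool" where
  "piecewise_quadratic_on \<equiv> piecewise_on quadratic_map"

subsection \<open>Optimization problems\<close>

text \<open>Minimization of \<open>J\<close> over \<open>F\<close>, with decision variable ranging over the
  finite-dimensional space \<open>E\<close>: convex quadratic cost, finitely many affine inequality
  constraints (an equality constraint is a pair of inequalities).\<close>

definition convex_quadratic_program ::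
    "'a::real_vector set \<Rightarrow> ('a \<Rightarrow> real) \<Rightarrow> 'a set \<Rightarrow> bool" where
  "convex_quadratic_program E J F \<longleftrightarrow>
     subspace E \<and> (\<exists>b. finite b \<and> span b = E) \<and>
     quadratic_map J \<and> convex_on E J \<and>
     (\<exists>G. finite G \<and> (\<forall>g\<in>G. affine_map g) \<and> F = {d\<in>E. \<forall>g\<in>G. g d \<le> (0::real)})"

definition optimal_value :: "('a \<Rightarrow> real) \<Rightarrow> 'a set \<Rightarrow> ereal" where
  "optimal_value J F = (INF d\<in>F. ereal (J d))"

definition minimizers :: "('a \<Rightarrow> real) \<Rightarrow> 'a set \<Rightarrow> 'a set" where
  "minimizers J F = {d. is_arg_min J (\<lambda>d. d \<in> F) d}"

subsection \<open>The optimal control problem\<close>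

text \<open>A decision variable is \<open>(z, v, zf, \<omega>)\<close> with index ranges \<open>{..<N}\<close>, \<open>{..<N}\<close>,
  \<open>{N..N + NZ}\<close> and \<open>{..<NS}\<close>.\<close>

type_synonym ('n, 'm) decision =
  "(nat \<Rightarrow> (real, 'n) vec) \<times> (nat \<Rightarrow> (real, 'm) vec) \<times> (nat \<Rightarrow> (real, 'n) vec) \<times> (nat \<Rightarrow> (real, 'n) vec)"

definition supported_on :: "nat set \<Rightarrow> (nat \<Rightarrow> 'a::zero) \<Rightarrow> bool" where
  "supported_on I s \<longleftrightarrow> (\<forall>k. k \<notin> I \<longrightarrow> s k = 0)"

definition decision_space :: "nat \<Rightarrow> nat \<Rightarrow> nat \<Rightarrow> ('n::finite, 'm::finite) decision set" where
  "decision_space N NS NZ = {(z, v, zf, \<omega>).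
     supported_on {..<N} z \<and> supported_on {..<N} v \<and>
     supported_on {N..N + NZ} zf \<and> supported_on {..<NS} \<omega>}"

definition joined :: "nat \<Rightarrow> (nat \<Rightarrow> 'a) \<Rightarrow> (nat \<Rightarrow> 'a) \<Rightarrow> nat \<Rightarrow> 'a" where
  "joined N z zf k = (if k < N then z k else zf k)"

definition cost ::
    "real^'n^'n \<Rightarrow> real^'m^'m \<Rightarrow> real^'n^'n \<Rightarrow> real^'n^'n \<Rightarrow> nat \<Rightarrow> nat
     \<Rightarrow> ('n::finite, 'm::finite) decision \<Rightarrow> real" where
  "cost Q R QZ P N NZ = (\<lambda>(z, v, zf, \<omega>).
     (\<Sum>k<N. z k \<bullet> (Q *v z k) + v k \<bullet> (R *v v k)) +
     (\<Sum>k=N..<N + NZ. zf k \<bullet> (QZ *v zf k)) +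
     zf (N + NZ) \<bullet> (P *v zf (N + NZ)))"

definition feasible_set ::
    "real^'n^'n \<Rightarrow> real^'m^'n \<Rightarrow> real^'n^'m \<Rightarrow> real^'n^'m \<Rightarrow> real
     \<Rightarrow> nat \<Rightarrow> (nat \<Rightarrow> real^'n) \<Rightarrow> (nat \<Rightarrow> real^'m) \<Rightarrow> (nat \<Rightarrow> real)
     \<Rightarrow> nat \<Rightarrow> (nat \<Rightarrow> real^'n)
     \<Rightarrow> nat \<Rightarrow> nat \<Rightarrow> nat \<Rightarrow> real^'n \<Rightarrow> ('n::finite, 'm::finite) decision set" where
  "feasible_set A B KS KZ \<alpha> p c d f q e N NS NZ x =
     {(z, v, zf, \<omega>) \<in> decision_space N NS NZ.
        let y = joined N z zf in
        x = y 0 + (1 / (1 - \<alpha>)) *\<^sub>R (\<Sum>j<NS. matpow (A + B ** KS) j *v \<omega> j) \<and>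
        (\<forall>j<NS. \<forall>i\<in>{1..q}. e i \<bullet> \<omega> j \<le> 1) \<and>
        (\<forall>k<N. y (k + 1) = A *v y k + B *v v k) \<and>
        (\<forall>k<N. \<forall>i\<in>{1..p}. c i \<bullet> y k + d i \<bullet> v k \<le> 1 - f i) \<and>
        (\<forall>k<NZ. y (N + k + 1) = (A + B ** KZ) *v y (N + k)) \<and>
        (\<forall>k\<le>NZ. \<forall>i\<in>{1..p}. (c i + d i v* KZ) \<bullet> y (N + k) \<le> 1 - f i)}"

end

theory Submission
  imports Defs
begin

text \<open>
  Every part is an instance of a parametric quadratic program with affine constraints and a
  positive semidefinite cost \<open>H d d\<close>. Minimizers exist by induction on the constraints, and by Farkas'
  lemma they are characterised by the Karush--Kuhn--Tucker conditions. For a fixed guess of the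
  active constraints these conditions are affine in parameter, decision and multipliers, so
  Fourier--Motzkin elimination of the last two shows that the parameters for which the guess is
  correct form a polyhedron; on it the \<open>H\<close>-definite component of the minimizer is a
  single-valued linear relation, hence affine. Continuity follows by pasting finitely many closed
  pieces. In the control problem this component is \<open>(z, v, zf)\<close>, and \<open>\<omega>\<close> is chosen by a second
  program: the sequence of least norm with \<open>x - z 0\<close> prescribed.
\<close>

text \<open>Decisions are functions on \<open>nat\<close>, so neither Euclidean polyhedra nor
  compactness arguments apply to them directly. Elimination, Farkas' lemma and the existence of
  minimizers are therefore purely algebraic, over real vector spaces; finite dimension enters only
  through finite spanning sets. The cost does not see \<open>\<omega>\<close>, and several
  disturbance sequences may represent the same remainder \<open>x - z 0\<close>. Two minimizers
  differ by a vector on which \<open>H\<close> vanishes: this determines \<open>(z, v, zf)\<close>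
  but leaves \<open>\<omega>\<close> open, so a selection is needed. As \<open>x\<close> meets
  \<open>\<omega>\<close> only in the remainder, the selection can be made once, on
  \<open>S\<close>, and composed with \<open>x - z0 x 0\<close>. Minimizing a norm makes the chosen
  sequence unique, so the same general theorem makes it piecewise affine. The cost has no linear
  term. Hence the zero nominal trajectory is optimal wherever it is feasible, which is exactly on
  \<open>S\<close>; this yields both statements about the sign of the value function.\<close>

lemma affine_map_linear: "linear L \<Longrightarrow> affine_map L"
  unfolding affine_map_def by (intro exI[of _ L] exI[of _ 0]) auto

lemma affine_map_const: "affine_map (\<lambda>x. b)"
  unfolding affine_map_def by (intro exI[of _ "\<lambda>x. 0"] exI[of _ b]) (auto intro: linearI)

lemma affine_map_compose:
  assumes "affine_map f" "affine_map g"
  shows "affine_map (\<lambda>x. f (g x))"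
proof -
  from assms obtain K a L b where "linear K" "f = (\<lambda>x. K x + a)" "linear L" "g = (\<lambda>x. L x + b)"
    unfolding affine_map_def by blast
  then have "linear (K \<circ> L)" "(\<lambda>x. f (g x)) = (\<lambda>x. (K \<circ> L) x + (K b + a))"
    by (auto simp: linear_compose linear_add fun_eq_iff)
  then show ?thesis unfolding affine_map_def by blast
qed

lemma affine_map_linear_compose:
  "linear L \<Longrightarrow> affine_map g \<Longrightarrow> affine_map (\<lambda>x. L (g x))"
  by (rule affine_map_compose[OF affine_map_linear])

lemma affine_map_add:
  assumes "affine_map f" "affine_map g"
  shows "affine_map (\<lambda>x. f x + g x)"
proof -
  from assms obtain K a L b where "linear K" "f = (\<lambda>x. K x + a)" "linear L" "g = (\<lambda>x. L x + b)"
    unfolding affine_map_def by blast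
  then have "linear (\<lambda>x. K x + L x)" "(\<lambda>x. f x + g x) = (\<lambda>x. (K x + L x) + (a + b))"
    by (auto simp: linear_compose_add fun_eq_iff)
  then show ?thesis unfolding affine_map_def by blast
qed

lemma affine_map_scaleR: "affine_map g \<Longrightarrow> affine_map (\<lambda>x. r *\<^sub>R g x)"
  by (rule affine_map_linear_compose) (auto intro!: linearI simp: scaleR_add_right)

lemma affine_map_mult: "affine_map g \<Longrightarrow> affine_map (\<lambda>x. r * g x :: real)"
  using affine_map_scaleR[of g r] by simp

lemma affine_map_uminus: "affine_map g \<Longrightarrow> affine_map (\<lambda>x. - g x)"
  using affine_map_scaleR[of g "-1"] by simp

lemma affine_map_diff:
  "affine_map f \<Longrightarrow> affine_map g \<Longrightarrow> affine_map (\<lambda>x. f x - g x)"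
  using affine_map_add[of f "\<lambda>x. - g x"] affine_map_uminus[of g] by simp

lemma affine_map_linear_part:
  assumes "affine_map g"
  shows "linear (\<lambda>x. g x - g 0)"
proof -
  from assms obtain L b where "linear L" "g = (\<lambda>x. L x + b)"
    unfolding affine_map_def by blast
  then show ?thesis by (simp add: linear_0)
qed

lemma affine_map_along_line:
  assumes "affine_map g"
  shows "g (x + t *\<^sub>R v) = g x + t *\<^sub>R (g v - g 0)"
  using linear_add[OF affine_map_linear_part[OF assms], of x "t *\<^sub>R v"]
    linear_scale[OF affine_map_linear_part[OF assms], of t v]
  by simp

lemma affine_map_convex_combination:
  assumes "affine_map g" "u + v = 1"
  shows "g (u *\<^sub>R x + v *\<^sub>R y) = u *\<^sub>R g x + v *\<^sub>R g y"
proof -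
  from assms obtain L b where *: "linear L" "g = (\<lambda>x. L x + b)"
    unfolding affine_map_def by blast
  have "b = u *\<^sub>R b + v *\<^sub>R b" using assms(2) by (simp flip: scaleR_add_left)
  with * show ?thesis by (simp add: linear_add linear_scale scaleR_add_right)
qed

text \<open>Formulated over real vector spaces because decisions and multipliers are functions.
  Constant \<open>g\<close> are allowed, so degenerate inequalities, which elimination can produce,
  are no special case.\<close>

definition polyhedral_set :: "'a::real_vector set \<Rightarrow> bool" where
  "polyhedral_set S \<longleftrightarrow>
     (\<exists>G. finite G \<and> (\<forall>g\<in>G. affine_map g) \<and> S = {x. \<forall>g\<in>G. g x \<le> (0::real)})"

lemma polyhedral_set_le:
  assumes "affine_map f" "affine_map g"
  shows "polyhedral_set {x. f x \<le> (g x :: real)}"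
  unfolding polyhedral_set_def
  by (rule exI[of _ "{\<lambda>x. f x - g x}"]) (use assms in \<open>auto intro: affine_map_diff\<close>)

lemma polyhedral_set_UNIV: "polyhedral_set UNIV"
  unfolding polyhedral_set_def by (rule exI[of _ "{}"]) auto

lemma polyhedral_set_Int:
  assumes "polyhedral_set S" "polyhedral_set T"
  shows "polyhedral_set (S \<inter> T)"
proof -
  from assms obtain G H where
    "finite G" "\<forall>g\<in>G. affine_map g" "S = {x. \<forall>g\<in>G. g x \<le> (0::real)}"
    "finite H" "\<forall>g\<in>H. affine_map g" "T = {x. \<forall>g\<in>H. g x \<le> (0::real)}"
    unfolding polyhedral_set_def by blast
  then show ?thesis unfolding polyhedral_set_def by (intro exI[of _ "G \<union> H"]) auto
qed

lemma polyhedral_set_conj: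
  "polyhedral_set {x. P x} \<Longrightarrow> polyhedral_set {x. Q x} \<Longrightarrow> polyhedral_set {x. P x \<and> Q x}"
  using polyhedral_set_Int[of "{x. P x}" "{x. Q x}"] by (simp add: Collect_conj_eq)

lemma polyhedral_set_ball:
  assumes "finite I" "\<And>i. i \<in> I \<Longrightarrow> polyhedral_set {x. P i x}"
  shows "polyhedral_set {x. \<forall>i\<in>I. P i x}"
  using assms
proof (induction I)
  case empty
  then show ?case by (simp add: polyhedral_set_UNIV)
next
  case (insert i I)
  then show ?case using polyhedral_set_conj[of "P i" "\<lambda>x. \<forall>i\<in>I. P i x"] by simp
qed

lemma polyhedral_set_eq_real:
  assumes "affine_map f" "affine_map g"
  shows "polyhedral_set {x. f x = (g x :: real)}"
  using polyhedral_set_conj[OF polyhedral_set_le[OF assms] polyhedral_set_le[OF assms(2,1)]]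
  by (simp add: order_eq_iff)

lemma polyhedral_set_eq:
  fixes f g :: "'a::real_vector \<Rightarrow> 'b::euclidean_space"
  assumes "affine_map f" "affine_map g"
  shows "polyhedral_set {x. f x = g x}"
proof -
  have "affine_map (\<lambda>x. h x \<bullet> b)" if "affine_map h" for h :: "'a \<Rightarrow> 'b" and b
    using affine_map_linear_compose[OF _ that, of "\<lambda>y. y \<bullet> b"]
    by (simp add: bounded_linear.linear bounded_linear_inner_left)
  then have "polyhedral_set {x. \<forall>b\<in>Basis. f x \<bullet> b = g x \<bullet> b}"
    using assms by (intro polyhedral_set_ball polyhedral_set_eq_real) auto
  then show ?thesis by (simp flip: euclidean_eq_iff)
qed

lemma polyhedral_set_vimage:
  assumes "polyhedral_set S" "affine_map h"
  shows "polyhedral_set {x. h x \<in> S}"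
proof -
  from assms(1) obtain G where "finite G" "\<forall>g\<in>G. affine_map g" "S = {x. \<forall>g\<in>G. g x \<le> (0::real)}"
    unfolding polyhedral_set_def by blast
  then show ?thesis unfolding polyhedral_set_def
    by (intro exI[of _ "(\<lambda>g x. g (h x)) ` G"]) (auto intro: affine_map_compose[OF _ assms(2)])
qed

lemma polyhedral_set_iff_polyhedron:
  fixes S :: "'a::euclidean_space set"
  shows "polyhedral_set S \<longleftrightarrow> polyhedron S"
proof
  assume "polyhedral_set S"
  then obtain G where G: "finite G" "\<forall>g\<in>G. affine_map g" "S = {x. \<forall>g\<in>G. g x \<le> (0::real)}"
    unfolding polyhedral_set_def by blast
  have "polyhedron {x. g x \<le> 0}" if g: "g \<in> G" for g
  proof -
    \<comment> \<open>The Riesz vector of the linear part of \<open>g\<close>. It may be zero; the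
      half-space is then empty or everything, which is still a polyhedron.\<close>
    define a where "a = (\<Sum>b\<in>Basis. (g b - g 0) *\<^sub>R b)"
    have lin: "linear (\<lambda>x. g x - g 0)" using G g affine_map_linear_part by blast
    have "g x - g 0 = a \<bullet> x" for x
    proof -
      have "g x - g 0 = (\<lambda>x. g x - g 0) (\<Sum>b\<in>Basis. (x \<bullet> b) *\<^sub>R b)"
        by (simp add: euclidean_representation)
      also have "\<dots> = (\<Sum>b\<in>Basis. (x \<bullet> b) *\<^sub>R (g b - g 0))"
        by (subst linear_sum[OF lin]) (simp add: linear_scale[OF lin])
      also have "\<dots> = a \<bullet> x"
        by (simp add: a_def inner_sum_left mult.commute inner_commute[of x])
      finally show ?thesis .
    qed
    then have "g x \<le> 0 \<longleftrightarrow> a \<bullet> x \<le> - g 0" for x by (smt (verit))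
    then have "{x. g x \<le> 0} = {x. a \<bullet> x \<le> - g 0}" by simp
    then show ?thesis by (simp only: polyhedron_halfspace_le)
  qed
  then have "polyhedron (\<Inter>g\<in>G. {x. g x \<le> 0})" using G(1) by (intro polyhedron_Inter) auto
  moreover have "(\<Inter>g\<in>G. {x. g x \<le> 0}) = S" using G(3) by auto
  ultimately show "polyhedron S" by simp
next
  assume "polyhedron S"
  then obtain F where F: "finite F" "S = \<Inter>F" "\<forall>h\<in>F. \<exists>a b. a \<noteq> 0 \<and> h = {x. a \<bullet> x \<le> b}"
    unfolding polyhedron_def by blast
  have "polyhedral_set {x. x \<in> h}" if h: "h \<in> F" for h
  proof -
    obtain a b where "h = {x. a \<bullet> x \<le> b}" using bspec[OF F(3) h] by auto
    then show ?thesis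
      using polyhedral_set_le[OF affine_map_linear[of "\<lambda>x. a \<bullet> x"] affine_map_const[of b]]
      by (simp add: bounded_linear.linear bounded_linear_inner_right)
  qed
  then have "polyhedral_set {x. \<forall>h\<in>F. x \<in> h}" using F(1) by (intro polyhedral_set_ball) auto
  then show "polyhedral_set S" using F(2) by (simp add: Inter_eq)
qed

section \<open>Projections of polyhedral sets\<close>

text \<open>The one-variable case, to which elimination reduces: \<open>Max L\<close> serves unless
  there is no lower bound, and then \<open>Min U\<close> or any number does.\<close>

lemma real_between_finite_sets:
  fixes L U :: "real set"
  assumes "finite L" "finite U" "\<And>l u. l \<in> L \<Longrightarrow> u \<in> U \<Longrightarrow> l \<le> u"
  shows "\<exists>t. (\<forall>l\<in>L. l \<le> t) \<and> (\<forall>u\<in>U. t \<le> u)"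
proof (cases "L = {}")
  case True
  then show ?thesis using assms(2)
    by (cases "U = {}") (auto intro!: exI[of _ "Min U"])
next
  case False
  then show ?thesis using assms by (intro exI[of _ "Max L"]) auto
qed

text \<open>One step of Fourier--Motzkin elimination: the inequalities in which \<open>t\<close> has slopes of
  opposite sign are combined pairwise.\<close>

lemma polyhedral_set_project_line:
  fixes v :: "'a::real_vector"
  assumes "polyhedral_set S"
  shows "polyhedral_set {x. \<exists>t. x + t *\<^sub>R v \<in> S}"
proof -
  from assms obtain G where G: "finite G" "\<forall>g\<in>G. affine_map g" "S = {x. \<forall>g\<in>G. g x \<le> (0::real)}"
    unfolding polyhedral_set_def by blast
  define s where "s g = g v - g 0" for g :: "'a \<Rightarrow> real"
  let ?Z = "{g\<in>G. s g = 0}" and ?P = "{g\<in>G. s g > 0}" and ?M = "{g\<in>G. s g < 0}"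
  have line: "g (x + t *\<^sub>R v) = g x + t * s g" if "g \<in> G" for g x t
    using affine_map_along_line[of g x t v] G(2) that by (simp add: s_def)
  have "(\<exists>t. x + t *\<^sub>R v \<in> S) \<longleftrightarrow>
      (\<forall>g\<in>?Z. g x \<le> 0) \<and> (\<forall>g\<in>?P. \<forall>h\<in>?M. s g * h x \<le> s h * g x)" for x
  proof (intro iffI conjI ballI)
    assume "\<exists>t. x + t *\<^sub>R v \<in> S"
    then obtain t where "x + t *\<^sub>R v \<in> S" by blast
    then have t: "g x + t * s g \<le> 0" if "g \<in> G" for g
      using G(3) line[OF that, of x t] that by auto
    show "g x \<le> 0" if "g \<in> ?Z" for g using t[of g] that by simp
    show "s g * h x \<le> s h * g x" if "g \<in> ?P" "h \<in> ?M" for g h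
    proof -
      \<comment> \<open>As \<open>s g > 0 > s h\<close>, the two products have opposite signs, and
        their terms in \<open>t\<close> cancel in the difference.\<close>
      have "s g * (h x + t * s h) \<le> 0" "s h * (g x + t * s g) \<ge> 0"
        using t[of g] t[of h] that by (auto intro: mult_nonneg_nonpos mult_nonpos_nonpos)
      then show ?thesis by (simp add: algebra_simps)
    qed
  next
    assume x: "(\<forall>g\<in>?Z. g x \<le> 0) \<and> (\<forall>g\<in>?P. \<forall>h\<in>?M. s g * h x \<le> s h * g x)"
    \<comment> \<open>Constraints of negative slope bound \<open>t\<close> from below, those of
      positive slope from above. Comparing two such bounds means dividing by
      \<open>s g * s h < 0\<close>.\<close>
    have "\<exists>t. (\<forall>l\<in>(\<lambda>h. - h x / s h) ` ?M. l \<le> t) \<and> (\<forall>u\<in>(\<lambda>g. - g x / s g) ` ?P. t \<le> u)"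
    proof (rule real_between_finite_sets)
      fix l u assume "l \<in> (\<lambda>h. - h x / s h) ` ?M" "u \<in> (\<lambda>g. - g x / s g) ` ?P"
      then obtain g h where gh: "g \<in> ?P" "h \<in> ?M" "l = - h x / s h" "u = - g x / s g" by auto
      with x have "s g * h x \<le> s h * g x" by blast
      then have "(s g * h x - s h * g x) / (s g * s h) \<ge> 0"
        using gh by (intro divide_nonpos_neg) (auto intro: mult_pos_neg)
      moreover have "u - l = (s g * h x - s h * g x) / (s g * s h)"
        unfolding gh(3,4) using gh(1,2) by (simp add: divide_simps)
      ultimately show "l \<le> u" by simp
    qed (use G(1) in auto)
    then obtain t where t: "\<And>h. h \<in> ?M \<Longrightarrow> - h x / s h \<le> t" "\<And>g. g \<in> ?P \<Longrightarrow> t \<le> - g x / s g"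
      by blast
    have "g x + t * s g \<le> 0" if "g \<in> G" for g
    proof (cases "s g" "0::real" rule: linorder_cases)
      case less
      then show ?thesis using t(1)[of g] that by (simp add: divide_simps split: if_splits)
    next
      case equal
      then show ?thesis using x that by auto
    next
      case greater
      then show ?thesis using t(2)[of g] that by (simp add: divide_simps split: if_splits)
    qed
    then show "\<exists>t. x + t *\<^sub>R v \<in> S" using G(3) line by auto
  qed
  moreover have "polyhedral_set {x. (\<forall>g\<in>?Z. g x \<le> 0) \<and> (\<forall>g\<in>?P. \<forall>h\<in>?M. s g * h x \<le> s h * g x)}"
    using G(1,2)
    by (intro polyhedral_set_conj polyhedral_set_ball polyhedral_set_le affine_map_mult affine_map_const)
      auto
  ultimately show ?thesis by simp
qed

text \<open>One generator is eliminated at a time, and the induction hypothesis is applied to the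
  set already projected along \<open>b\<close>; hence \<open>S\<close> is arbitrary in the
  induction.\<close>

lemma polyhedral_set_project_span:
  fixes B :: "'a::real_vector set"
  assumes "finite B" "polyhedral_set S"
  shows "polyhedral_set {x. \<exists>u\<in>span B. x + u \<in> S}"
  using assms
proof (induction B arbitrary: S)
  case empty
  then show ?case by simp
next
  case (insert b B)
  have "(\<exists>u\<in>span (insert b B). x + u \<in> S) \<longleftrightarrow> (\<exists>u\<in>span B. x + u \<in> {y. \<exists>t. y + t *\<^sub>R b \<in> S})" for x
  proof
    assume "\<exists>u\<in>span (insert b B). x + u \<in> S"
    then obtain u k where "x + u \<in> S" "u - k *\<^sub>R b \<in> span B" by (auto simp: span_breakdown_eq)
    then show "\<exists>u\<in>span B. x + u \<in> {y. \<exists>t. y + t *\<^sub>R b \<in> S}"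
      by (intro bexI[of _ "u - k *\<^sub>R b"]) (auto intro!: exI[of _ k] simp: algebra_simps)
  next
    assume "\<exists>u\<in>span B. x + u \<in> {y. \<exists>t. y + t *\<^sub>R b \<in> S}"
    then obtain u t where "u \<in> span B" "x + u + t *\<^sub>R b \<in> S" by auto
    then show "\<exists>u\<in>span (insert b B). x + u \<in> S"
      by (intro bexI[of _ "u + t *\<^sub>R b"]) (auto simp: span_breakdown_eq add.assoc intro!: exI[of _ t])
  qed
  with insert.IH[OF polyhedral_set_project_line[OF insert.prems, of b]] show ?case by simp
qed

section \<open>Finitely generated subspaces\<close>

text \<open>A property of the set and not of the type: the type of sequences is
  infinite-dimensional, its subspaces of fixed finite support are not.\<close>

definition finitely_spanned :: "'a::real_vector set \<Rightarrow> bool" where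
  "finitely_spanned E \<longleftrightarrow> (\<exists>b. finite b \<and> span b = E)"

lemma finitely_spanned_subspace: "finitely_spanned E \<Longrightarrow> subspace E"
  unfolding finitely_spanned_def by auto

lemma finitely_spanned_Times:
  assumes "finitely_spanned E" "finitely_spanned F"
  shows "finitely_spanned (E \<times> F)"
proof -
  from assms obtain b c where bc: "finite b" "span b = E" "finite c" "span c = F"
    unfolding finitely_spanned_def by blast
  have b: "span ((\<lambda>x. (x, 0)) ` b) = (\<lambda>x. (x, 0)) ` E"
    using bc(2) by (subst linear_span_image) (auto simp: linear_iff)
  have c: "span ((\<lambda>y. (0, y)) ` c) = (\<lambda>y. (0, y)) ` F"
    using bc(4) by (subst linear_span_image) (auto simp: linear_iff)
  have "span ((\<lambda>x. (x, 0)) ` b \<union> (\<lambda>y. (0, y)) ` c) = E \<times> F"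
    unfolding span_Un b c
  proof (intro equalityI subsetI)
    fix p assume "p \<in> E \<times> F"
    then show "p \<in> {x + y |x y. x \<in> (\<lambda>x. (x, 0)) ` E \<and> y \<in> (\<lambda>y. (0, y)) ` F}"
      by (intro CollectI exI[of _ "(fst p, 0)"] exI[of _ "(0, snd p)"]) auto
  qed auto
  then show ?thesis unfolding finitely_spanned_def using bc(1,3)
    by (intro exI[of _ "(\<lambda>x. (x, 0)) ` b \<union> (\<lambda>y. (0, y)) ` c"]) simp
qed

lemma sum_fun_apply: "(\<Sum>i\<in>I. f i) k = (\<Sum>i\<in>I. f i k)"
  by (induction I rule: infinite_finite_induct) auto

text \<open>The generators carry one basis vector at one index. The index type is arbitrary because
  multipliers are indexed by the constraint functions themselves.\<close>

lemma finitely_spanned_finite_support: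
  assumes "finite I"
  shows "finitely_spanned {f :: 'k \<Rightarrow> 'e::euclidean_space. \<forall>k. k \<notin> I \<longrightarrow> f k = 0}"
proof -
  define u :: "'k \<Rightarrow> 'e \<Rightarrow> 'k \<Rightarrow> 'e" where "u i b = (\<lambda>k. if k = i then b else 0)" for i b
  let ?E = "{f :: 'k \<Rightarrow> 'e. \<forall>k. k \<notin> I \<longrightarrow> f k = 0}"
  let ?B = "(\<lambda>(i, b). u i b) ` (I \<times> Basis)"
  have "f \<in> span ?B" if "f \<in> ?E" for f
  proof -
    have "f = (\<Sum>i\<in>I. \<Sum>b\<in>Basis. (f i \<bullet> b) *\<^sub>R u i b)"
    proof
      fix k
      have "(\<Sum>b\<in>Basis. (f i \<bullet> b) *\<^sub>R u i b) k = (if k = i then f i else 0)" for i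
        by (simp add: sum_fun_apply scaleR_fun_def u_def euclidean_representation)
      then show "f k = (\<Sum>i\<in>I. \<Sum>b\<in>Basis. (f i \<bullet> b) *\<^sub>R u i b) k"
        using that assms by (simp add: sum_fun_apply[of _ I])
    qed
    moreover have "(\<Sum>i\<in>I. \<Sum>b\<in>Basis. (f i \<bullet> b) *\<^sub>R u i b) \<in> span ?B"
      by (intro span_sum span_scale span_base) auto
    ultimately show ?thesis by simp
  qed
  moreover have "span ?B \<subseteq> ?E"
    by (rule span_minimal) (auto simp: subspace_def u_def scaleR_fun_def)
  ultimately have "span ?B = ?E" by blast
  moreover have "finite ?B" using assms by simp
  ultimately show ?thesis unfolding finitely_spanned_def by blast
qed

text \<open>Eliminating \<open>y\<close> means moving from \<open>(x, 0)\<close> along directions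
  \<open>(0, y)\<close>, so the projection is a slice of a set given by
  \<open>polyhedral_set_project_span\<close>.\<close>

lemma polyhedral_set_project:
  fixes S :: "('a::real_vector \<times> 'b::real_vector) set"
  assumes "finitely_spanned E" "polyhedral_set S"
  shows "polyhedral_set {x. \<exists>y\<in>E. (x, y) \<in> S}"
proof -
  obtain b where b: "finite b" "span b = E" using assms(1) unfolding finitely_spanned_def by blast
  have "span ((\<lambda>y. (0::'a, y)) ` b) = (\<lambda>y. (0, y)) ` E"
    using b by (auto intro!: linear_span_image simp: linear_iff)
  then have "(\<exists>y\<in>E. (x, y) \<in> S) \<longleftrightarrow> (x, 0) \<in> {z. \<exists>u\<in>span ((\<lambda>y. (0::'a, y)) ` b). z + u \<in> S}" for x
    by auto
  moreover have "polyhedral_set {x. (x, 0) \<in> {z. \<exists>u\<in>span ((\<lambda>y. (0::'a, y)) ` b). z + u \<in> S}}"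
    using b assms(2)
    by (intro polyhedral_set_vimage polyhedral_set_project_span affine_map_linear)
      (auto simp: linear_iff)
  ultimately show ?thesis by simp
qed

section \<open>Farkas' lemma\<close>

text \<open>In the induction step, a point violating the conclusion for the remaining functionals
  provides a direction \<open>s\<close> along which the new functional is projected out.\<close>

lemma farkas:
  fixes a :: "'i \<Rightarrow> 'a::real_vector \<Rightarrow> real" and h :: "'a \<Rightarrow> real"
  assumes "finite I" "subspace E" "\<And>i. i \<in> I \<Longrightarrow> linear (a i)" "linear h"
    and "\<And>t. t \<in> E \<Longrightarrow> (\<And>i. i \<in> I \<Longrightarrow> a i t \<le> 0) \<Longrightarrow> h t \<le> 0"
  shows "\<exists>l. (\<forall>i\<in>I. l i \<ge> 0) \<and> (\<forall>t\<in>E. h t = (\<Sum>i\<in>I. l i * a i t))"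
  using assms(1,3,4,5)
proof (induction I arbitrary: a h)
  case empty
  have "h t = 0" if "t \<in> E" for t
    using empty.prems(3)[of t] empty.prems(3)[of "- t"] that assms(2)
    by (simp add: subspace_neg linear_neg[OF empty.prems(2)])
  then show ?case by simp
next
  case (insert j I)
  note lin = insert.prems(1,2)
  show ?case
  proof (cases "\<forall>t\<in>E. (\<forall>i\<in>I. a i t \<le> 0) \<longrightarrow> h t \<le> 0")
    case True
    then obtain l where l: "\<forall>i\<in>I. l i \<ge> 0" "\<forall>t\<in>E. h t = (\<Sum>i\<in>I. l i * a i t)"
      using insert.IH[of a h] lin by blast
    have "(\<Sum>i\<in>I. (l(j := 0)) i * a i t) = (\<Sum>i\<in>I. l i * a i t)" for t
      using insert.hyps by (intro sum.cong) auto
    with l insert.hyps show ?thesis by (intro exI[of _ "l(j := 0)"]) auto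
  next
    case False
    then obtain s0 where s0: "s0 \<in> E" "\<forall>i\<in>I. a i s0 \<le> 0" "h s0 > 0" by force
    then have "a j s0 > 0" using insert.prems(3)[of s0] by force
    \<comment> \<open>Normalised to \<open>a j s = 1\<close>, so that
      \<open>t - a j t *\<^sub>R s\<close> lies in the kernel of \<open>a j\<close>. The induction
      hypothesis is used for the functionals composed with this projection.\<close>
    define s where "s = (1 / a j s0) *\<^sub>R s0"
    have s: "s \<in> E" "\<forall>i\<in>I. a i s \<le> 0" "h s > 0" "a j s = 1"
      using s0 \<open>a j s0 > 0\<close> assms(2) lin
      by (auto simp: s_def subspace_scale linear_scale divide_le_0_iff)
    have "\<exists>l. (\<forall>i\<in>I. l i \<ge> 0) \<and>
        (\<forall>t\<in>E. h t - a j t * h s = (\<Sum>i\<in>I. l i * (a i t - a j t * a i s)))"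
    proof (rule insert.IH)
      show "linear (\<lambda>t. a i t - a j t * a i s)" if "i \<in> I" for i
        using lin that by (auto simp: linear_iff algebra_simps)
      show "linear (\<lambda>t. h t - a j t * h s)"
        using lin by (auto simp: linear_iff algebra_simps)
      fix t assume t: "t \<in> E" "\<And>i. i \<in> I \<Longrightarrow> a i t - a j t * a i s \<le> 0"
      have "h (t - a j t *\<^sub>R s) \<le> 0"
        using s t lin assms(2)
        by (intro insert.prems(3))
          (auto simp: subspace_diff subspace_scale linear_diff linear_scale)
      then show "h t - a j t * h s \<le> 0" using lin by (simp add: linear_diff linear_scale)
    qed
    then obtain l where l: "\<forall>i\<in>I. l i \<ge> 0"
      "\<And>t. t \<in> E \<Longrightarrow> h t - a j t * h s = (\<Sum>i\<in>I. l i * (a i t - a j t * a i s))" by blast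
    \<comment> \<open>What remains as the coefficient of \<open>a j t\<close> after collecting
      terms; it is nonnegative because \<open>h s > 0\<close> and all
      \<open>a i s \<le> 0\<close>.\<close>
    let ?c = "h s - (\<Sum>i\<in>I. l i * a i s)"
    have "(\<Sum>i\<in>I. l i * a i s) \<le> 0" using l s by (intro sum_nonpos) (auto intro: mult_nonneg_nonpos)
    then have "?c \<ge> 0" using s by simp
    moreover have "h t = (\<Sum>i\<in>insert j I. (l(j := ?c)) i * a i t)" if "t \<in> E" for t
    proof -
      have "(\<Sum>i\<in>I. (l(j := ?c)) i * a i t) = (\<Sum>i\<in>I. l i * a i t)"
        using insert.hyps by (intro sum.cong) auto
      moreover have "(\<Sum>i\<in>I. l i * (a i t - a j t * a i s)) =
          (\<Sum>i\<in>I. l i * a i t) - a j t * (\<Sum>i\<in>I. l i * a i s)"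
        by (simp add: right_diff_distrib sum_subtractf sum_distrib_left mult.left_commute)
      ultimately show ?thesis using l(2)[OF that] insert.hyps by (simp add: algebra_simps)
    qed
    ultimately show ?thesis using l(1) by (intro exI[of _ "l(j := ?c)"]) auto
  qed
qed

section \<open>Parametric convex quadratic programs\<close>

text \<open>Projection along some \<open>b\<close> with \<open>s b \<noteq> 0\<close> maps the span
  onto the kernel, so the projected generators generate it. This keeps the hyperplanes in
  \<open>attains_minimum\<close> finitely generated.\<close>

lemma span_kernel:
  fixes s :: "'a::real_vector \<Rightarrow> real"
  assumes "finite B" "linear s"
  shows "\<exists>C. finite C \<and> span C = {t \<in> span B. s t = 0}"
proof (cases "\<forall>b\<in>B. s b = 0")
  case True
  then have "s t = 0" if "t \<in> span B" for t
    using linear_eq_0_on_span[OF assms(2)] that by blast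
  then show ?thesis using assms(1) by (intro exI[of _ B]) auto
next
  case False
  then obtain b where b: "b \<in> B" "s b \<noteq> 0" by auto
  define f where "f t = t - (s t / s b) *\<^sub>R b" for t
  have "linear f"
    using assms(2) by (auto simp: linear_iff f_def algebra_simps add_divide_distrib)
  then have "span (f ` B) = f ` span B" by (rule linear_span_image)
  also have "\<dots> = {t \<in> span B. s t = 0}"
  proof (intro equalityI subsetI)
    fix t assume "t \<in> {t \<in> span B. s t = 0}"
    then show "t \<in> f ` span B" by (intro image_eqI[of _ _ t]) (auto simp: f_def)
  next
    fix t assume "t \<in> f ` span B"
    then show "t \<in> {t \<in> span B. s t = 0}"
      using b linear_diff[OF assms(2)] linear_scale[OF assms(2)]
      by (auto simp: f_def intro: span_diff span_scale span_base)
  qed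
  finally show ?thesis using assms(1) by (intro exI[of _ "f ` B"]) auto
qed

section \<open>Positive semidefinite forms and the existence of minimizers\<close>

locale psd_form =
  fixes H :: "'b::real_vector \<Rightarrow> 'b \<Rightarrow> real"
  assumes bilinear: "bilinear H"
    and form_sym: "H x y = H y x"
    and psd: "H x x \<ge> 0"
begin

lemmas H_simps = bilinear_ladd[OF bilinear] bilinear_radd[OF bilinear] bilinear_lmul[OF bilinear]
  bilinear_rmul[OF bilinear] bilinear_lsub[OF bilinear] bilinear_rsub[OF bilinear]

lemma linear_H: "linear (H d)"
  using bilinear by (simp add: bilinear_def)

lemma H_add_square: "H (d + t) (d + t) = H d d + 2 * H d t + H t t"
  by (simp add: H_simps form_sym[of t d])

text \<open>The gap between the two sides is \<open>u * v * H (d - d') (d - d')\<close>.\<close>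

lemma H_convex:
  assumes "0 \<le> u" "0 \<le> v" "u + v = 1"
  shows "H (u *\<^sub>R d + v *\<^sub>R d') (u *\<^sub>R d + v *\<^sub>R d') \<le> u * H d d + v * H d' d'"
proof -
  have v: "v = 1 - u" using assms by simp
  have "u * H d d + v * H d' d' - H (u *\<^sub>R d + v *\<^sub>R d') (u *\<^sub>R d + v *\<^sub>R d') = u * v * H (d - d') (d - d')"
    unfolding v by (simp add: H_simps form_sym[of d' d] algebra_simps power2_eq_square)
  moreover have "u * v * H (d - d') (d - d') \<ge> 0" using assms psd by simp
  ultimately show ?thesis by linarith
qed

text \<open>The degenerate case of Cauchy--Schwarz: along \<open>y + s *\<^sub>R b\<close> the form
  is affine in \<open>s\<close>, hence negative somewhere unless its slope \<open>2 * H y b\<close>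
  vanishes. The chosen \<open>s\<close> would give it the value -1.\<close>

lemma null_orthogonal:
  assumes "H b b = 0"
  shows "H b y = 0"
proof (rule ccontr)
  assume "H b y \<noteq> 0"
  moreover define s where "s = - (H y y + 1) / (2 * H y b)"
  ultimately have "2 * (s * H y b) = - (H y y + 1)" using form_sym[of b y] by simp
  then have "H (y + s *\<^sub>R b) (y + s *\<^sub>R b) = - 1"
    unfolding H_add_square using assms by (simp add: H_simps)
  with psd[of "y + s *\<^sub>R b"] show False by simp
qed

text \<open>Gram--Schmidt for a semidefinite form: the induction hypothesis is used for
  \<open>a\<close> and for the new generator \<open>b\<close>, after which only the component of
  \<open>a + t\<close> along \<open>b + r\<close> has to be removed.\<close>

lemma orthogonal_projection:
  assumes "finite B"
  shows "\<exists>t\<in>span B. \<forall>u\<in>span B. H (a + t) u = 0"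
  using assms
proof (induction B arbitrary: a)
  case empty
  then show ?case by (simp add: bilinear_rzero[OF bilinear])
next
  case (insert b B)
  obtain t where t: "t \<in> span B" "\<And>u. u \<in> span B \<Longrightarrow> H (a + t) u = 0"
    using insert.IH[of a] by auto
  obtain r where r: "r \<in> span B" "\<And>u. u \<in> span B \<Longrightarrow> H (b + r) u = 0"
    using insert.IH[of b] by auto
  \<comment> \<open>If \<open>H (b + r) (b + r) = 0\<close>, this is \<open>0\<close> by the convention for division,
    and \<open>b + r\<close> is orthogonal to everything.\<close>
  define k where "k = - H (a + t) (b + r) / H (b + r) (b + r)"
  have k: "H (a + t) (b + r) + k * H (b + r) (b + r) = 0"
    using null_orthogonal[of "b + r" "a + t"] form_sym[of "a + t" "b + r"]
    by (cases "H (b + r) (b + r) = 0") (auto simp: k_def)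
  let ?t = "t + k *\<^sub>R (b + r)"
  have sub: "span B \<subseteq> span (insert b B)" by (intro span_mono) auto
  have "?t \<in> span (insert b B)"
    using t(1) r(1) sub by (intro span_add span_scale) (auto intro: span_base)
  moreover have "H (a + ?t) u = 0" if u: "u \<in> span (insert b B)" for u
  proof -
    obtain c where "u - c *\<^sub>R b \<in> span B" using u by (auto simp: span_breakdown_eq)
    then have "u - c *\<^sub>R b - c *\<^sub>R r \<in> span B" using r(1) span_diff span_scale by blast
    moreover have "u = (u - c *\<^sub>R b - c *\<^sub>R r) + c *\<^sub>R (b + r)" by (simp add: algebra_simps)
    ultimately obtain w where w: "w \<in> span B" and u: "u = w + c *\<^sub>R (b + r)" by blast
    have "H (a + ?t) u = H ((a + t) + k *\<^sub>R (b + r)) (w + c *\<^sub>R (b + r))"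
      unfolding u by (simp only: add.assoc)
    also have "\<dots> = H (a + t) w + k * H (b + r) w
        + c * (H (a + t) (b + r) + k * H (b + r) (b + r))"
      by (simp only: bilinear_ladd[OF bilinear, of "a + t"] bilinear_radd[OF bilinear, of _ w]
          bilinear_lmul[OF bilinear] bilinear_rmul[OF bilinear]) (simp add: algebra_simps)
    finally show ?thesis using t(2)[OF w] r(2)[OF w] k by simp
  qed
  ultimately show ?case by blast
qed

text \<open>Induction on the constraints: if the minimizer without the constraint \<open>g\<close> violates \<open>g\<close>,
  then by convexity it suffices to minimize on the hyperplane \<open>g = 0\<close>.\<close>

lemma attains_minimum:
  assumes "finite G" "\<forall>g\<in>G. affine_map g" "finite B"
    and "{d. d - a \<in> span B \<and> (\<forall>g\<in>G. g d \<le> (0::real))} \<noteq> {}"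
  shows "\<exists>d. d - a \<in> span B \<and> (\<forall>g\<in>G. g d \<le> 0) \<and>
    (\<forall>e. e - a \<in> span B \<longrightarrow> (\<forall>g\<in>G. g e \<le> 0) \<longrightarrow> H d d \<le> H e e)"
  using assms
proof (induction G arbitrary: a B)
  case empty
  obtain t where t: "t \<in> span B" "\<And>u. u \<in> span B \<Longrightarrow> H (a + t) u = 0"
    using orthogonal_projection[OF empty.prems(2), of a] by auto
  have "H (a + t) (a + t) \<le> H e e" if "e - a \<in> span B" for e
  proof -
    have "e - a - t \<in> span B" using that t(1) by (rule span_diff)
    then have "H (a + t) (e - (a + t)) = 0" using t(2) by (simp add: algebra_simps)
    then show ?thesis using H_add_square[of "a + t" "e - (a + t)"] psd[of "e - (a + t)"] by simp
  qed
  then show ?case using t(1) by (intro exI[of _ "a + t"]) auto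
next
  case (insert g G)
  have g: "affine_map g" and G: "\<forall>h\<in>G. affine_map h" using insert.prems(1) by auto
  have gd: "g (x + t) = g x + (g t - g 0)" for x t
    using affine_map_along_line[OF g, of x 1 t] by simp
  have "{d. d - a \<in> span B \<and> (\<forall>h\<in>G. h d \<le> 0)} \<noteq> {}" using insert.prems(3) by auto
  from insert.IH[OF G insert.prems(2) this] obtain d where d: "d - a \<in> span B" "\<forall>h\<in>G. h d \<le> 0"
    "\<And>e. e - a \<in> span B \<Longrightarrow> \<forall>h\<in>G. h e \<le> 0 \<Longrightarrow> H d d \<le> H e e" by auto
  show ?case
  proof (cases "g d \<le> 0")
    case True
    then show ?thesis using d by (intro exI[of _ d]) auto
  next
    case False
    \<comment> \<open>\<open>d\<close> violates \<open>g\<close> and \<open>e\<close> satisfies it,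
      so the segment between them meets the hyperplane; \<open>s\<close> is the parameter of the
      crossing. As \<open>d\<close> is no worse than \<open>e\<close>, convexity bounds the value
      there by that at \<open>e\<close>.\<close>
    have cross: "\<exists>m. m - a \<in> span B \<and> (\<forall>h\<in>G. h m \<le> 0) \<and> g m = 0 \<and> H m m \<le> H e e"
      if e: "e - a \<in> span B" "\<forall>h\<in>insert g G. h e \<le> 0" for e
    proof -
      define s where "s = g d / (g d - g e)"
      have s: "0 \<le> s" "s \<le> 1" "(1 - s) * g d + s * g e = 0"
        using False e(2) by (auto simp: s_def field_simps)
      define m where "m = (1 - s) *\<^sub>R d + s *\<^sub>R e"
      have "m - a = (1 - s) *\<^sub>R (d - a) + s *\<^sub>R (e - a)" by (simp add: m_def algebra_simps)
      then have "m - a \<in> span B" using span_add[OF span_scale[OF d(1)] span_scale[OF e(1)]] by simp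
      moreover have "h m \<le> 0" if "h \<in> G" for h
        using affine_map_convex_combination[of h "1 - s" s d e] G d(2) e(2) s(1,2) that
        by (auto simp: m_def intro!: add_nonpos_nonpos mult_nonneg_nonpos)
      moreover have "g m = 0"
        using affine_map_convex_combination[OF g, of "1 - s" s d e] s(3) by (simp add: m_def)
      moreover have "H m m \<le> (1 - s) * H d d + s * H e e"
        unfolding m_def using s by (intro H_convex) auto
      moreover have "(1 - s) * H d d \<le> (1 - s) * H e e"
        using d(3)[OF e(1)] e(2) s by (intro mult_left_mono) auto
      then have "(1 - s) * H d d + s * H e e \<le> H e e" by (simp add: algebra_simps)
      ultimately show ?thesis by (intro exI[of _ m]) auto
    qed
    obtain e0 where e0: "e0 - a \<in> span B" "\<forall>h\<in>insert g G. h e0 \<le> 0" using insert.prems(3) by auto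
    obtain m0 where m0: "m0 - a \<in> span B" "\<forall>h\<in>G. h m0 \<le> 0" "g m0 = 0"
      using cross[OF e0] by auto
    \<comment> \<open>\<open>span C\<close> consists of the directions that leave \<open>g\<close>
      unchanged, so \<open>m0 + span C\<close> is the hyperplane within \<open>a + span B\<close>.
      Base point and generators change here, hence the induction with arbitrary \<open>a\<close> and
      \<open>B\<close>.\<close>
    obtain C where C: "finite C" "span C = {t \<in> span B. g t - g 0 = 0}"
      using span_kernel[OF insert.prems(2) affine_map_linear_part[OF g]] by auto
    have "{d. d - m0 \<in> span C \<and> (\<forall>h\<in>G. h d \<le> 0)} \<noteq> {}"
      using m0(2) by (auto intro!: exI[of _ m0] simp: span_zero)
    from insert.IH[OF G C(1) this] obtain d2 where d2: "d2 - m0 \<in> span C" "\<forall>h\<in>G. h d2 \<le> 0"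
      "\<And>e. e - m0 \<in> span C \<Longrightarrow> \<forall>h\<in>G. h e \<le> 0 \<Longrightarrow> H d2 d2 \<le> H e e" by auto
    have "(d2 - m0) + (m0 - a) \<in> span B" using d2(1) m0(1) C(2) by (intro span_add) auto
    then have "d2 - a \<in> span B" by simp
    moreover have "g d2 = 0" using gd[of m0 "d2 - m0"] m0(3) d2(1) C(2) by simp
    moreover have "H d2 d2 \<le> H e e" if e: "e - a \<in> span B" "\<forall>h\<in>insert g G. h e \<le> 0" for e
    proof -
      obtain m where m: "m - a \<in> span B" "\<forall>h\<in>G. h m \<le> 0" "g m = 0" "H m m \<le> H e e"
        using cross[OF e] by auto
      have "(m - a) - (m0 - a) \<in> span B" using m(1) m0(1) by (rule span_diff)
      moreover have "g (m - m0) - g 0 = 0" using gd[of m0 "m - m0"] m(3) m0(3) by simp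
      ultimately have "m - m0 \<in> span C" using C(2) by simp
      from d2(3)[OF this m(2)] m(4) show ?thesis by linarith
    qed
    ultimately show ?thesis using d2(2) by (intro exI[of _ d2]) auto
  qed
qed

end

section \<open>Optimality conditions and their dependence on the parameter\<close>

locale parametric_qp = psd_form H for H :: "'b::real_vector \<Rightarrow> 'b \<Rightarrow> real" +
  fixes B :: "'b set" and G :: "('a::real_vector \<times> 'b \<Rightarrow> real) set"
  assumes finite_B: "finite B"
    and finite_G: "finite G"
    and affine: "g \<in> G \<Longrightarrow> affine_map g"
begin

definition fiber :: "'a \<Rightarrow> 'b set" where
  "fiber x = {d \<in> span B. \<forall>g\<in>G. g (x, d) \<le> 0}"

definition solutions :: "'a \<Rightarrow> 'b set" where
  "solutions x = minimizers (\<lambda>d. H d d) (fiber x)"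

definition slope :: "('a \<times> 'b \<Rightarrow> real) \<Rightarrow> 'a \<times> 'b \<Rightarrow> real" where
  "slope g p = g p - g 0"

lemma linear_slope: "g \<in> G \<Longrightarrow> linear (slope g)"
  unfolding slope_def using affine affine_map_linear_part by blast

lemma linear_slope_snd:
  assumes "g \<in> G" shows "linear (\<lambda>t. slope g (0, t))"
proof -
  have "linear (slope g \<circ> (\<lambda>t. (0, t)))"
    by (rule linear_compose[OF _ linear_slope[OF assms]]) (auto simp: linear_iff)
  then show ?thesis by (simp add: o_def)
qed

lemma slope_diff: "g \<in> G \<Longrightarrow> slope g (p - q) = g p - g q"
  by (simp add: linear_diff[OF linear_slope]) (simp add: slope_def)

lemma solutions_iff:
  "d \<in> solutions x \<longleftrightarrow> d \<in> fiber x \<and> (\<forall>d'\<in>fiber x. H d d \<le> H d' d')"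
  unfolding solutions_def minimizers_def is_arg_min_def by (auto simp: not_less)

text \<open>Parameters are mixed along with decisions: this serves the convexity of the domain and
  of the value function, while \<open>x = y\<close> gives convexity of a single feasible
  set.\<close>

lemma fiber_convex:
  assumes "d \<in> fiber x" "d' \<in> fiber y" "0 \<le> u" "0 \<le> v" "u + v = 1"
  shows "u *\<^sub>R d + v *\<^sub>R d' \<in> fiber (u *\<^sub>R x + v *\<^sub>R y)"
proof -
  have "g (u *\<^sub>R (x, d) + v *\<^sub>R (y, d')) \<le> 0" if "g \<in> G" for g
    using assms that
    by (subst affine_map_convex_combination[OF affine])
      (auto simp: fiber_def intro!: add_nonpos_nonpos mult_nonneg_nonpos)
  with assms show ?thesis by (auto simp: fiber_def span_add span_scale)
qed

lemma domain_polyhedral: "polyhedral_set {x. fiber x \<noteq> {}}"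
proof -
  have "polyhedral_set {x. \<exists>d\<in>span B. (x, d) \<in> {p. \<forall>g\<in>G. g p \<le> 0}}"
    using finite_B finite_G affine
    by (intro polyhedral_set_project) (auto simp: finitely_spanned_def polyhedral_set_def)
  moreover have "{x. \<exists>d\<in>span B. (x, d) \<in> {p. \<forall>g\<in>G. g p \<le> 0}} = {x. fiber x \<noteq> {}}"
    by (auto simp: fiber_def)
  ultimately show ?thesis by simp
qed

text \<open>First-order condition: \<open>2 * H d t\<close> is the one-sided derivative of the cost
  along \<open>t\<close>. Feasibility is asked only up to \<open>r\<close>, since inactive
  constraints may block longer steps.\<close>

lemma solution_direction:
  assumes d: "d \<in> solutions x" and r: "r > 0"
    and feas: "\<And>s. 0 < s \<Longrightarrow> s \<le> r \<Longrightarrow> d + s *\<^sub>R t \<in> fiber x"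
  shows "H d t \<ge> 0"
proof (rule ccontr)
  assume neg: "\<not> H d t \<ge> 0"
  \<comment> \<open>Ensures \<open>s * H t t \<le> - H d t\<close>, hence
    \<open>2 * H d t + s * H t t \<le> H d t < 0\<close>. The summand 1 keeps the denominator
    positive.\<close>
  define s where "s = min r (- H d t / (1 + H t t))"
  have pos: "1 + H t t > 0" using psd[of t] by linarith
  then have s: "0 < s" "s \<le> r" using r neg by (auto simp: s_def divide_neg_pos)
  have "s \<le> - H d t / (1 + H t t)" by (simp add: s_def)
  then have "s * (1 + H t t) \<le> - H d t" using pos by (simp add: field_simps)
  moreover have "s * H t t \<le> s * (1 + H t t)" using s by (simp add: algebra_simps)
  ultimately have "2 * H d t + s * H t t < 0" using neg by linarith
  then have "s * (2 * H d t + s * H t t) < 0" using s by (simp add: mult_pos_neg)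
  moreover have "H d d \<le> H (d + s *\<^sub>R t) (d + s *\<^sub>R t)"
    using d feas[OF s] unfolding solutions_iff by blast
  moreover have "H (d + s *\<^sub>R t) (d + s *\<^sub>R t) = H d d + s * (2 * H d t + s * H t t)"
    by (simp add: H_simps form_sym[of t d] algebra_simps)
  ultimately show False by simp
qed

text \<open>Expand \<open>H d' d'\<close> around \<open>d\<close>: the values agree and the
  first-order term is nonnegative by \<open>solution_direction\<close>, so the second-order term
  must vanish.\<close>

lemma solutions_unique:
  assumes "d \<in> solutions x" "d' \<in> solutions x"
  shows "H (d' - d) (d' - d) = 0"
proof -
  have "H d (d' - d) \<ge> 0"
  proof (rule solution_direction[OF assms(1), of 1])
    fix s :: real assume "0 < s" "s \<le> 1"
    then have "(1 - s) *\<^sub>R d + s *\<^sub>R d' \<in> fiber ((1 - s) *\<^sub>R x + s *\<^sub>R x)"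
      using assms by (intro fiber_convex) (auto simp: solutions_iff)
    then show "d + s *\<^sub>R (d' - d) \<in> fiber x"
      by (simp add: algebra_simps)
  qed simp
  moreover have "H d' d' = H d d" using assms by (auto simp: solutions_iff intro: antisym)
  moreover have "H d' d' = H d d + 2 * H d (d' - d) + H (d' - d) (d' - d)"
    using H_add_square[of d "d' - d"] by simp
  ultimately show ?thesis using psd[of "d' - d"] by linarith
qed

text \<open>The gradient of the Lagrangian vanishes on \<open>span B\<close>. The derivative of the
  cost is \<open>2 * H d t\<close>; the factor 2 is absorbed into the multipliers.\<close>

definition stationary :: "'b \<Rightarrow> (('a \<times> 'b \<Rightarrow> real) \<Rightarrow> real) \<Rightarrow> bool" where
  "stationary d l \<longleftrightarrow> (\<forall>t\<in>span B. H d t + (\<Sum>g\<in>G. l g * slope g (0, t)) = 0)"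

text \<open>The Karush--Kuhn--Tucker conditions, with multipliers carried by the guessed set \<open>J\<close> of
  active constraints. For fixed \<open>J\<close> they are affine in \<open>(x, d, l)\<close>.\<close>

definition kkt :: "('a \<times> 'b \<Rightarrow> real) set \<Rightarrow> 'a \<Rightarrow> 'b \<Rightarrow> (('a \<times> 'b \<Rightarrow> real) \<Rightarrow> real) \<Rightarrow> bool" where
  "kkt J x d l \<longleftrightarrow> d \<in> fiber x \<and> stationary d l \<and>
     (\<forall>g\<in>J. g (x, d) = 0) \<and> (\<forall>g\<in>G. 0 \<le> l g) \<and> (\<forall>g. g \<notin> J \<longrightarrow> l g = 0)"

lemma linear_stationarity:
  "linear (\<lambda>t. H d t + (\<Sum>g\<in>G. l g * slope g (0, t)))"
proof -
  have "linear (\<lambda>t. l g * slope g (0, t))" if "g \<in> G" for g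
    using linear_slope_snd[OF that] by (auto simp: linear_iff algebra_simps)
  then show ?thesis using linear_H by (intro linear_compose_add linear_compose_sum) auto
qed

text \<open>Linearity in \<open>t\<close> leaves one equation per generator, so stationarity is a
  finite system.\<close>

lemma stationary_iff:
  "stationary d l \<longleftrightarrow> (\<forall>b\<in>B. H d b + (\<Sum>g\<in>G. l g * slope g (0, b)) = 0)"
  unfolding stationary_def
  using linear_eq_0_on_span[OF linear_stationarity, of B d l] span_base[of _ B] by blast

text \<open>Weak duality: passing to a feasible \<open>d'\<close> cannot increase an active
  constraint, so the multiplier sum is nonpositive and stationarity gives
  \<open>H d (d' - d) \<ge> 0\<close>. The second-order term is nonnegative as well.\<close>

lemma kkt_imp_solution:
  assumes "kkt J x d l"
  shows "d \<in> solutions x"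
  unfolding solutions_iff
proof (intro conjI ballI)
  show d: "d \<in> fiber x" using assms by (simp add: kkt_def)
  fix d' assume d': "d' \<in> fiber x"
  have "l g * slope g (0, d' - d) \<le> 0" if "g \<in> G" for g
  proof (cases "g \<in> J")
    case True
    have "slope g (0, d' - d) = g (x, d') - g (x, d)"
      using slope_diff[OF that, of "(x, d')" "(x, d)"] by simp
    also have "\<dots> \<le> 0" using True d' that assms by (auto simp: kkt_def fiber_def)
    finally show ?thesis using assms that by (auto simp: kkt_def intro: mult_nonneg_nonpos)
  qed (use assms in \<open>auto simp: kkt_def\<close>)
  then have "(\<Sum>g\<in>G. l g * slope g (0, d' - d)) \<le> 0" by (rule sum_nonpos)
  moreover have "d' - d \<in> span B" using d d' by (simp add: fiber_def span_diff)
  ultimately have "H d (d' - d) \<ge> 0" using assms by (force simp: kkt_def stationary_def)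
  then show "H d d \<le> H d' d'"
    using H_add_square[of d "d' - d"] psd[of "d' - d"] by simp
qed

text \<open>A direction that increases no active constraint stays feasible for a short step, so
  \<open>solution_direction\<close> supplies the hypothesis of \<open>farkas\<close> for the linear
  parts of the active constraints.\<close>

lemma solution_imp_kkt:
  assumes d: "d \<in> solutions x"
  shows "\<exists>J\<subseteq>G. \<exists>l. kkt J x d l"
proof -
  define J where "J = {g\<in>G. g (x, d) = 0}"
  have df: "d \<in> span B" "g (x, d) \<le> 0" if "g \<in> G" for g
    using d that by (auto simp: solutions_iff fiber_def)
  have "d \<in> fiber x" using d by (simp add: solutions_iff)
  have "\<exists>l. (\<forall>g\<in>J. l g \<ge> 0) \<and> (\<forall>t\<in>span B. - H d t = (\<Sum>g\<in>J. l g * slope g (0, t)))"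
  proof (rule farkas)
    show "finite J" using finite_G by (simp add: J_def)
    show "linear (\<lambda>t. slope g (0, t))" if "g \<in> J" for g
      using linear_slope_snd that by (simp add: J_def)
    show "linear (\<lambda>t. - H d t)" using linear_H by (rule linear_compose_neg)
    fix t assume t: "t \<in> span B" "\<And>g. g \<in> J \<Longrightarrow> slope g (0, t) \<le> 0"
    \<comment> \<open>Only inactive constraints that grow along \<open>t\<close> limit the step;
      each becomes active at the ratio used below.\<close>
    let ?U = "{g\<in>G - J. slope g (0, t) > 0}"
    have "\<exists>r>0. \<forall>g\<in>?U. r \<le> - g (x, d) / slope g (0, t)"
    proof (cases "?U = {}")
      case False
      have "- g (x, d) / slope g (0, t) > 0" if "g \<in> ?U" for g
        using that \<open>d \<in> fiber x\<close> by (force simp: J_def fiber_def intro!: divide_pos_pos)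
      with False show ?thesis using finite_G
        by (intro exI[of _ "Min ((\<lambda>g. - g (x, d) / slope g (0, t)) ` ?U)"]) auto
    qed (auto intro: exI[of _ 1])
    then obtain r where r: "r > 0" "\<And>g. g \<in> ?U \<Longrightarrow> r \<le> - g (x, d) / slope g (0, t)" by blast
    have "H d t \<ge> 0"
    proof (rule solution_direction[OF d r(1)])
      fix s :: real assume s: "0 < s" "s \<le> r"
      have "g (x, d + s *\<^sub>R t) \<le> 0" if g: "g \<in> G" for g
      proof -
        have eq: "g (x, d + s *\<^sub>R t) = g (x, d) + s * slope g (0, t)"
          using affine_map_along_line[OF affine[OF g], of "(x, d)" s "(0, t)"] by (simp add: slope_def)
        consider "g \<in> J" | "g \<in> ?U" | "slope g (0, t) \<le> 0" using g by fastforce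
        then show ?thesis
        proof cases
          case 2
          then have "r * slope g (0, t) \<le> - g (x, d)" using r(2)[OF 2] by (simp add: field_simps)
          moreover have "s * slope g (0, t) \<le> r * slope g (0, t)"
            using 2 s by (intro mult_right_mono) auto
          ultimately show ?thesis using eq by linarith
        next
          case 3
          then have "s * slope g (0, t) \<le> 0" using s by (intro mult_nonneg_nonpos) auto
          with eq df(2)[OF g] show ?thesis by linarith
        qed (use eq t(2) s in \<open>auto simp: J_def intro: mult_nonneg_nonpos\<close>)
      qed
      then show "d + s *\<^sub>R t \<in> fiber x"
        using \<open>d \<in> fiber x\<close> t(1) by (auto simp: fiber_def span_add span_scale)
    qed
    then show "- H d t \<le> 0" by simp
  qed simp
  then obtain l where l: "\<forall>g\<in>J. l g \<ge> 0"
    "\<And>t. t \<in> span B \<Longrightarrow> - H d t = (\<Sum>g\<in>J. l g * slope g (0, t))" by blast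
  define m where "m g = (if g \<in> J then l g else 0)" for g
  have "(\<Sum>g\<in>G. m g * slope g (0, t)) = (\<Sum>g\<in>J. l g * slope g (0, t))" for t
    using finite_G by (intro sum.mono_neutral_cong_right) (auto simp: m_def J_def)
  then have "stationary d m" using l(2) by (force simp: stationary_def)
  then have "kkt J x d m" using l(1) \<open>d \<in> fiber x\<close> by (auto simp: kkt_def m_def J_def)
  moreover have "J \<subseteq> G" by (auto simp: J_def)
  ultimately show ?thesis by (intro exI conjI)
qed

lemma kkt_polyhedral:
  assumes "J \<subseteq> G"
  shows "polyhedral_set {x. \<exists>d l. kkt J x d l}"
proof -
  \<comment> \<open>Multipliers are functions on all maps; confining their support to the finite set
    \<open>J\<close> puts them in a finitely spanned space that can be eliminated.\<close>
  let ?L = "{l :: ('a \<times> 'b \<Rightarrow> real) \<Rightarrow> real. \<forall>g. g \<notin> J \<longrightarrow> l g = 0}"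
  let ?S = "{p :: 'a \<times> 'b \<times> (('a \<times> 'b \<Rightarrow> real) \<Rightarrow> real).
      (\<forall>g\<in>G. g (fst p, fst (snd p)) \<le> 0) \<and> (\<forall>g\<in>J. g (fst p, fst (snd p)) = 0) \<and>
      (\<forall>g\<in>G. 0 \<le> snd (snd p) g) \<and>
      (\<forall>b\<in>B. H (fst (snd p)) b + (\<Sum>g\<in>G. snd (snd p) g * slope g (0, b)) = 0)}"
  have "finite J" using assms finite_G by (rule finite_subset)
  have aff1: "affine_map (\<lambda>p::'a \<times> 'b \<times> (('a \<times> 'b \<Rightarrow> real) \<Rightarrow> real). g (fst p, fst (snd p)))"
    if "g \<in> G" for g
    by (rule affine_map_compose[OF affine[OF that] affine_map_linear]) (auto simp: linear_iff)
  have aff2: "affine_map (\<lambda>p::'a \<times> 'b \<times> (('a \<times> 'b \<Rightarrow> real) \<Rightarrow> real). snd (snd p) g)" for g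
    by (rule affine_map_linear) (auto simp: linear_iff scaleR_fun_def)
  have aff3: "affine_map (\<lambda>p::'a \<times> 'b \<times> (('a \<times> 'b \<Rightarrow> real) \<Rightarrow> real).
      H (fst (snd p)) b + (\<Sum>g\<in>G. snd (snd p) g * slope g (0, b)))" for b
    by (rule affine_map_linear)
      (auto simp: linear_iff scaleR_fun_def H_simps sum.distrib distrib_right sum_distrib_left
        distrib_left mult.assoc)
  have "polyhedral_set ?S"
    using finite_G finite_B \<open>finite J\<close> assms
    by (intro polyhedral_set_conj polyhedral_set_ball polyhedral_set_le polyhedral_set_eq_real
        aff1 aff2 aff3 affine_map_const) auto
  then have "polyhedral_set {x. \<exists>y\<in>span B \<times> ?L. (x, y) \<in> ?S}"
    using finite_B \<open>finite J\<close>
    by (intro polyhedral_set_project finitely_spanned_Times finitely_spanned_finite_support)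
      (auto simp: finitely_spanned_def)
  moreover have "{x. \<exists>y\<in>span B \<times> ?L. (x, y) \<in> ?S} = {x. \<exists>d l. kkt J x d l}"
    by (auto simp: kkt_def stationary_iff fiber_def)
  ultimately show ?thesis by simp
qed

text \<open>The equality part of the Karush--Kuhn--Tucker conditions, homogenised, is a linear relation
  between the parameter and the solution. By semidefiniteness of \<open>H\<close> it is single-valued up to
  directions on which \<open>H\<close> vanishes, and a single-valued linear relation extends to a linear map.\<close>

lemma kkt_affine:
  fixes \<pi> :: "'b \<Rightarrow> 'c::real_vector"
  assumes "linear \<pi>" "\<And>t. t \<in> span B \<Longrightarrow> H t t = 0 \<Longrightarrow> \<pi> t = 0" "J \<subseteq> G"
  shows "\<exists>h. affine_map h \<and> (\<forall>x d l. kkt J x d l \<longrightarrow> \<pi> d = h x)"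
proof (cases "\<exists>x d l. kkt J x d l")
  case False
  then show ?thesis using affine_map_const by blast
next
  case True
  then obtain x0 d0 l0 where k0: "kkt J x0 d0 l0" by blast
  \<comment> \<open>Sign conditions are dropped, since differences of multipliers may be negative.
    \<open>R\<close> then contains every difference of pairs \<open>(x, d)\<close> that satisfy
    \<open>kkt J\<close> with some multipliers.\<close>
  define R where "R = {(\<xi>, \<delta>). \<delta> \<in> span B \<and> (\<forall>g\<in>J. slope g (\<xi>, \<delta>) = 0) \<and>
      (\<exists>l. (\<forall>g. g \<notin> J \<longrightarrow> l g = 0) \<and> stationary \<delta> l)}"
  have add: "p + q \<in> R" if "p \<in> R" "q \<in> R" for p q
  proof -
    obtain \<xi> \<delta> l where p: "p = (\<xi>, \<delta>)" "\<delta> \<in> span B" "\<forall>g\<in>J. slope g (\<xi>, \<delta>) = 0"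
      "\<forall>g. g \<notin> J \<longrightarrow> l g = 0" "stationary \<delta> l" using \<open>p \<in> R\<close> unfolding R_def by blast
    obtain \<xi>' \<delta>' l' where q: "q = (\<xi>', \<delta>')" "\<delta>' \<in> span B" "\<forall>g\<in>J. slope g (\<xi>', \<delta>') = 0"
      "\<forall>g. g \<notin> J \<longrightarrow> l' g = 0" "stationary \<delta>' l'" using \<open>q \<in> R\<close> unfolding R_def by blast
    have "slope g (\<xi> + \<xi>', \<delta> + \<delta>') = 0" if "g \<in> J" for g
      using linear_add[OF linear_slope, of g "(\<xi>, \<delta>)" "(\<xi>', \<delta>')"] p q that assms(3) by auto
    moreover have "stationary (\<delta> + \<delta>') (\<lambda>g. l g + l' g)"
      unfolding stationary_def
    proof
      fix t assume "t \<in> span B"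
      then have "(H \<delta> t + (\<Sum>g\<in>G. l g * slope g (0, t))) + (H \<delta>' t + (\<Sum>g\<in>G. l' g * slope g (0, t))) = 0"
        using p q by (simp add: stationary_def)
      then show "H (\<delta> + \<delta>') t + (\<Sum>g\<in>G. (l g + l' g) * slope g (0, t)) = 0"
        by (simp add: H_simps distrib_right sum.distrib algebra_simps)
    qed
    ultimately show ?thesis using p q
      by (auto simp: R_def span_add intro!: exI[of _ "\<lambda>g. l g + l' g"])
  qed
  have scale: "r *\<^sub>R p \<in> R" if "p \<in> R" for r p
  proof -
    obtain \<xi> \<delta> l where p: "p = (\<xi>, \<delta>)" "\<delta> \<in> span B" "\<forall>g\<in>J. slope g (\<xi>, \<delta>) = 0"
      "\<forall>g. g \<notin> J \<longrightarrow> l g = 0" "stationary \<delta> l" using \<open>p \<in> R\<close> unfolding R_def by blast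
    have "slope g (r *\<^sub>R \<xi>, r *\<^sub>R \<delta>) = 0" if "g \<in> J" for g
      using linear_scale[OF linear_slope, of g r "(\<xi>, \<delta>)"] p that assms(3) by auto
    moreover have "stationary (r *\<^sub>R \<delta>) (\<lambda>g. r * l g)"
      unfolding stationary_def
    proof
      fix t assume "t \<in> span B"
      then have "r * (H \<delta> t + (\<Sum>g\<in>G. l g * slope g (0, t))) = 0"
        using p by (simp add: stationary_def)
      then show "H (r *\<^sub>R \<delta>) t + (\<Sum>g\<in>G. r * l g * slope g (0, t)) = 0"
        by (simp add: H_simps distrib_left sum_distrib_left mult.assoc del: mult_eq_0_iff)
    qed
    ultimately show ?thesis using p
      by (auto simp: R_def span_scale intro!: exI[of _ "\<lambda>g. r * l g"])
  qed
  have "stationary 0 (\<lambda>g. 0)" using bilinear_lzero[OF bilinear] by (simp add: stationary_def)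
  then have "0 \<in> R" using linear_0[OF linear_slope] assms(3)
    by (auto simp: R_def zero_prod_def span_zero intro!: exI[of _ "\<lambda>g. 0"])
  then have "subspace R" using add scale by (simp add: subspace_def)
  moreover have "linear (\<lambda>(\<xi>, \<delta>). (\<xi>, \<pi> \<delta>))"
    using assms(1) by (auto simp: linear_iff)
  ultimately have sub: "subspace ((\<lambda>(\<xi>, \<delta>). (\<xi>, \<pi> \<delta>)) ` R)" by (intro linear_subspace_image)
  have single: "\<pi> \<delta> = 0" if "(0, \<delta>) \<in> R" for \<delta>
  proof -
    from that obtain l where l: "\<delta> \<in> span B" "\<forall>g\<in>J. slope g (0, \<delta>) = 0"
      "\<forall>g. g \<notin> J \<longrightarrow> l g = 0" "stationary \<delta> l" unfolding R_def by blast
    \<comment> \<open>Complementarity: one of the two factors vanishes, so stationarity tested with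
      \<open>\<delta>\<close> itself reads \<open>H \<delta> \<delta> = 0\<close>.\<close>
    have "l g * slope g (0, \<delta>) = 0" for g using l by (cases "g \<in> J") auto
    then have "(\<Sum>g\<in>G. l g * slope g (0, \<delta>)) = 0" by (intro sum.neutral) blast
    then have "H \<delta> \<delta> = 0" using bspec[OF l(4)[unfolded stationary_def] l(1)] by simp
    with l show ?thesis using assms(2) by blast
  qed
  have inj: "inj_on fst ((\<lambda>(\<xi>, \<delta>). (\<xi>, \<pi> \<delta>)) ` R)"
  proof (rule inj_onI)
    fix p q assume "p \<in> (\<lambda>(\<xi>, \<delta>). (\<xi>, \<pi> \<delta>)) ` R" "q \<in> (\<lambda>(\<xi>, \<delta>). (\<xi>, \<pi> \<delta>)) ` R" "fst p = fst q"
    then obtain \<xi> \<delta> \<delta>' where "p = (\<xi>, \<pi> \<delta>)" "q = (\<xi>, \<pi> \<delta>')" "(\<xi>, \<delta>) \<in> R" "(\<xi>, \<delta>') \<in> R" by auto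
    moreover from this have "(0, \<delta> - \<delta>') \<in> R" using subspace_diff[OF \<open>subspace R\<close>] by fastforce
    ultimately show "p = q" using single linear_diff[OF assms(1)] by fastforce
  qed
  \<comment> \<open>The inverse of \<open>fst\<close> on this graph, extended to the whole parameter
    space; its second component is the linear part of the affine map.\<close>
  obtain K where K: "linear K" "\<And>p. p \<in> (\<lambda>(\<xi>, \<delta>). (\<xi>, \<pi> \<delta>)) ` R \<Longrightarrow> K (fst p) = p"
    using linear_exists_left_inverse_on[OF linear_fst sub inj] by blast
  have "\<pi> d = snd (K (x - x0)) + \<pi> d0" if k: "kkt J x d l" for x d l
  proof -
    have "(x - x0, d - d0) \<in> R"
    proof -
      have "slope g (x - x0, d - d0) = 0" if "g \<in> J" for g
        using slope_diff[of g "(x, d)" "(x0, d0)"] that k k0 subsetD[OF assms(3) that]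
        by (auto simp: kkt_def)
      moreover have "stationary (d - d0) (\<lambda>g. l g - l0 g)"
        using k k0 unfolding kkt_def stationary_def
        by (auto simp: H_simps left_diff_distrib sum_subtractf) (smt (verit))
      ultimately show ?thesis using k k0
        by (auto simp: R_def kkt_def fiber_def span_diff intro!: exI[of _ "\<lambda>g. l g - l0 g"])
    qed
    then have "K (x - x0) = (x - x0, \<pi> (d - d0))" using K(2) by force
    then show ?thesis by (simp add: linear_diff[OF assms(1)])
  qed
  moreover have "affine_map (\<lambda>x. snd (K (x - x0)) + \<pi> d0)"
    using K(1)
    by (intro affine_map_add affine_map_const affine_map_linear_compose[OF linear_snd]
        affine_map_linear_compose[of K] affine_map_diff affine_map_linear linear_id[unfolded id_def])
  ultimately show ?thesis by blast
qed

section \<open>The minimizer map and the value function\<close>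

lemma solutions_nonempty:
  assumes "fiber x \<noteq> {}"
  shows "solutions x \<noteq> {}"
proof -
  let ?G = "(\<lambda>g d. g (x, d)) ` G"
  have "affine_map (\<lambda>d. (x, d))"
    unfolding affine_map_def
    by (intro exI[of _ "\<lambda>d. (0, d)"] exI[of _ "(x, 0)"]) (auto simp: linear_iff)
  then have aff: "\<forall>g\<in>?G. affine_map g" using affine_map_compose[OF affine] by blast
  have "{d. d - 0 \<in> span B \<and> (\<forall>g\<in>?G. g d \<le> 0)} = fiber x" by (auto simp: fiber_def)
  then have "{d. d - 0 \<in> span B \<and> (\<forall>g\<in>?G. g d \<le> 0)} \<noteq> {}" using assms by simp
  from attains_minimum[OF finite_imageI[OF finite_G] aff finite_B this] obtain d
    where "d \<in> fiber x" "\<And>e. e \<in> fiber x \<Longrightarrow> H d d \<le> H e e"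
    by (auto simp: fiber_def)
  then have "d \<in> solutions x" by (simp add: solutions_iff)
  then show ?thesis by auto
qed

text \<open>Mixing minimizers for \<open>x\<close> and \<open>y\<close> gives a feasible decision
  for the mixed parameter; \<open>H_convex\<close> bounds its cost and the minimum is no
  larger.\<close>

lemma value_convex:
  assumes V: "\<And>x d. d \<in> solutions x \<Longrightarrow> V x = H d d"
  shows "convex_on {x. fiber x \<noteq> {}} V"
  unfolding convex_on_def
proof (intro conjI ballI allI impI convexI)
  fix x y and u v :: real
  assume uv: "0 \<le> u" "0 \<le> v" "u + v = 1"
    and xy: "x \<in> {x. fiber x \<noteq> {}}" "y \<in> {x. fiber x \<noteq> {}}"
  obtain d e where de: "d \<in> solutions x" "e \<in> solutions y"
    using solutions_nonempty[of x] solutions_nonempty[of y] xy by auto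
  then have m: "u *\<^sub>R d + v *\<^sub>R e \<in> fiber (u *\<^sub>R x + v *\<^sub>R y)"
    using uv by (intro fiber_convex) (auto simp: solutions_iff)
  then show "u *\<^sub>R x + v *\<^sub>R y \<in> {x. fiber x \<noteq> {}}" by blast
  then obtain s where s: "s \<in> solutions (u *\<^sub>R x + v *\<^sub>R y)"
    using solutions_nonempty[of "u *\<^sub>R x + v *\<^sub>R y"] by auto
  then have "H s s \<le> H (u *\<^sub>R d + v *\<^sub>R e) (u *\<^sub>R d + v *\<^sub>R e)"
    using m by (auto simp: solutions_iff)
  also have "\<dots> \<le> u * H d d + v * H e e" using uv by (rule H_convex)
  finally show "V (u *\<^sub>R x + v *\<^sub>R y) \<le> u * V x + v * V y" using V s de by simp
qed

text \<open>One piece for each guess of active constraints. Pieces may overlap, but \<open>h\<close>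
  does not depend on the guess: by \<open>solutions_unique\<close> all minimizers for
  \<open>x\<close> have the same \<open>\<pi>\<close>.\<close>

lemma solutions_piecewise:
  fixes \<pi> :: "'b \<Rightarrow> 'c::real_vector"
  assumes "linear \<pi>" "\<And>t. t \<in> span B \<Longrightarrow> H t t = 0 \<Longrightarrow> \<pi> t = 0"
  shows "\<exists>h \<P>. (\<forall>x. \<forall>d\<in>solutions x. \<pi> d = h x) \<and>
    finite \<P> \<and> (\<forall>X\<in>\<P>. polyhedral_set X) \<and> {x. fiber x \<noteq> {}} = \<Union>\<P> \<and>
    (\<forall>X\<in>\<P>. \<exists>h'. affine_map h' \<and> (\<forall>x\<in>X. h x = h' x))"
proof -
  define h where "h x = \<pi> (SOME d. d \<in> solutions x)" for x
  have h: "\<pi> d = h x" if d: "d \<in> solutions x" for x d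
  proof -
    let ?d = "SOME d. d \<in> solutions x"
    have "?d \<in> solutions x" using d by (rule someI)
    then have "\<pi> (d - ?d) = 0"
      using d solutions_unique assms(2) by (auto simp: solutions_iff fiber_def span_diff)
    then show ?thesis by (simp add: linear_diff[OF assms(1)] h_def)
  qed
  let ?P = "(\<lambda>J. {x. \<exists>d l. kkt J x d l}) ` Pow G"
  have "{x. fiber x \<noteq> {}} = \<Union>?P"
  proof (intro equalityI subsetI)
    fix x assume "x \<in> {x. fiber x \<noteq> {}}"
    then obtain d where "d \<in> solutions x" using solutions_nonempty[of x] by auto
    from solution_imp_kkt[OF this] obtain J l where "J \<subseteq> G" "kkt J x d l" by auto
    then show "x \<in> \<Union>?P" by (intro UnionI imageI CollectI exI) auto
  qed (auto simp: kkt_def)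
  moreover have "\<exists>h'. affine_map h' \<and> (\<forall>x\<in>X. h x = h' x)" if "X \<in> ?P" for X
  proof -
    from that obtain J where J: "J \<subseteq> G" "X = {x. \<exists>d l. kkt J x d l}" by blast
    from kkt_affine[OF assms(1,2) J(1)] obtain h'
      where "affine_map h'" "\<And>x d l. kkt J x d l \<Longrightarrow> \<pi> d = h' x" by blast
    then show ?thesis using J(2) h kkt_imp_solution by (intro exI[of _ h']) force
  qed
  ultimately show ?thesis using finite_G h kkt_polyhedral
    by (intro exI[of _ h] exI[of _ ?P]) auto
qed

end

text \<open>\<open>H\<close> need not be definite, so only the component \<open>\<pi>\<close> of the minimizers on which it is
  definite is a function of the parameter.\<close>

theorem parametric_qp_minimizers:
  fixes H :: "'b::real_vector \<Rightarrow> 'b \<Rightarrow> real" and M :: "('a::euclidean_space \<times> 'b) set"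
    and \<pi> :: "'b \<Rightarrow> 'c::real_vector"
  assumes "bilinear H" "\<And>x y. H x y = H y x" "\<And>x. H x x \<ge> 0"
    and "finitely_spanned E" "polyhedral_set M"
    and "linear \<pi>" "\<And>t. t \<in> E \<Longrightarrow> H t t = 0 \<Longrightarrow> \<pi> t = 0"
    and F: "\<And>x. F x = {d \<in> E. (x, d) \<in> M}"
    and D: "D = {x. F x \<noteq> {}}"
  shows "\<forall>x\<in>D. minimizers (\<lambda>d. H d d) (F x) \<noteq> {}"
    and "\<exists>h. (\<forall>x. \<forall>d\<in>minimizers (\<lambda>d. H d d) (F x). \<pi> d = h x) \<and> piecewise_affine_on D h"
    and "(\<And>x d. d \<in> minimizers (\<lambda>d. H d d) (F x) \<Longrightarrow> V x = H d d) \<Longrightarrow> convex_on D V"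
proof -
  obtain B where B: "finite B" "span B = E" using assms(4) unfolding finitely_spanned_def by auto
  obtain G where G: "finite G" "\<forall>g\<in>G. affine_map g" "M = {p. \<forall>g\<in>G. g p \<le> (0::real)}"
    using assms(5) unfolding polyhedral_set_def by auto
  interpret parametric_qp H B G
    using assms(1-3) B(1) G(1,2) by unfold_locales auto
  have fiber: "fiber x = F x" for x using B(2) G(3) by (auto simp: fiber_def F)
  have sol: "minimizers (\<lambda>d. H d d) (F x) = solutions x" for x
    by (simp add: solutions_def fiber)
  show "\<forall>x\<in>D. minimizers (\<lambda>d. H d d) (F x) \<noteq> {}"
    using solutions_nonempty by (auto simp: sol fiber D)
  show "(\<And>x d. d \<in> minimizers (\<lambda>d. H d d) (F x) \<Longrightarrow> V x = H d d) \<Longrightarrow> convex_on D V"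
    using value_convex[of V] by (simp add: sol fiber D)
  obtain h \<P> where h: "\<forall>x. \<forall>d\<in>solutions x. \<pi> d = h x" "finite \<P>" "\<forall>X\<in>\<P>. polyhedral_set X"
    "{x. fiber x \<noteq> {}} = \<Union>\<P>" "\<forall>X\<in>\<P>. \<exists>h'. affine_map h' \<and> (\<forall>x\<in>X. h x = h' x)"
    using solutions_piecewise[OF assms(6), unfolded B(2), OF assms(7)] by auto
  have "polyhedron D" using domain_polyhedral
    unfolding polyhedral_set_iff_polyhedron by (simp add: D fiber)
  then have "piecewise_affine_on D h" unfolding piecewise_on_def
    using h(2-5) unfolding polyhedral_set_iff_polyhedron D fiber
    by (intro conjI exI[of _ \<P>]) auto
  with h(1) show "\<exists>h. (\<forall>x. \<forall>d\<in>minimizers (\<lambda>d. H d d) (F x). \<pi> d = h x) \<and> piecewise_affine_on D h"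
    by (auto simp: sol)
qed

section \<open>Piecewise affine and piecewise quadratic functions\<close>

lemma continuous_on_piecewise:
  assumes "piecewise_on \<Phi> D g" "\<And>h. \<Phi> h \<Longrightarrow> continuous_on UNIV h"
  shows "continuous_on D g"
proof -
  from assms(1) obtain \<P> where P: "finite \<P>" "\<forall>X\<in>\<P>. polyhedron X" "D = \<Union>\<P>"
    "\<forall>X\<in>\<P>. \<exists>h. \<Phi> h \<and> (\<forall>x\<in>X. g x = h x)"
    unfolding piecewise_on_def by auto
  have "continuous_on (\<Union>X\<in>\<P>. X) g"
  proof (rule continuous_on_closed_Union[OF P(1)])
    fix X assume X: "X \<in> \<P>"
    then show "closed X" using P(2) polyhedron_imp_closed by auto
    obtain h where "\<Phi> h" "\<forall>x\<in>X. g x = h x" using P(4) X by auto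
    then show "continuous_on X g"
      using assms(2)[of h] continuous_on_subset[of UNIV h X] continuous_on_cong[of X X g h] by simp
  qed
  then show ?thesis using P(3) by simp
qed

text \<open>\<open>T\<close> may depend on \<open>x\<close>, as it does for the remainder
  \<open>x - z0 x 0\<close> of the control problem.\<close>

lemma piecewise_on_transform:
  assumes "piecewise_on \<Phi> D g" "\<And>h. \<Phi> h \<Longrightarrow> \<Psi> (\<lambda>x. T x (h x))"
  shows "piecewise_on \<Psi> D (\<lambda>x. T x (g x))"
proof -
  from assms(1) obtain \<P> where P: "polyhedron D" "finite \<P>" "\<forall>X\<in>\<P>. polyhedron X" "D = \<Union>\<P>"
    "\<forall>X\<in>\<P>. \<exists>h. \<Phi> h \<and> (\<forall>x\<in>X. g x = h x)"
    unfolding piecewise_on_def by auto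
  have "\<exists>h'. \<Psi> h' \<and> (\<forall>x\<in>X. T x (g x) = h' x)" if X: "X \<in> \<P>" for X
  proof -
    obtain h where "\<Phi> h" "\<forall>x\<in>X. g x = h x" using bspec[OF P(5) X] by auto
    then show ?thesis using assms(2) by (intro exI[of _ "\<lambda>x. T x (h x)"]) simp
  qed
  then show ?thesis unfolding piecewise_on_def using P(1-4) by (intro conjI exI[of _ \<P>]) auto
qed

text \<open>Preimages are formed with the affine representative \<open>a X\<close>, defined on the
  whole space, rather than with \<open>f\<close>; this makes each piece
  \<open>X \<inter> {x. a X x \<in> Y}\<close> polyhedral.\<close>

lemma piecewise_affine_on_compose:
  assumes f: "piecewise_affine_on D f" and g: "piecewise_affine_on E g"
    and "\<And>x. x \<in> D \<Longrightarrow> f x \<in> E"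
  shows "piecewise_affine_on D (\<lambda>x. g (f x))"
proof -
  from f obtain \<P> where P: "polyhedron D" "finite \<P>" "\<forall>X\<in>\<P>. polyhedron X" "D = \<Union>\<P>"
    "\<forall>X\<in>\<P>. \<exists>h. affine_map h \<and> (\<forall>x\<in>X. f x = h x)"
    unfolding piecewise_on_def by auto
  from bchoice[OF P(5)] obtain a
    where a: "\<And>X. X \<in> \<P> \<Longrightarrow> affine_map (a X)" "\<And>X x. X \<in> \<P> \<Longrightarrow> x \<in> X \<Longrightarrow> f x = a X x"
    by auto
  from g obtain \<Q> where Q: "finite \<Q>" "\<forall>X\<in>\<Q>. polyhedron X" "E = \<Union>\<Q>"
    "\<forall>X\<in>\<Q>. \<exists>h. affine_map h \<and> (\<forall>x\<in>X. g x = h x)"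
    unfolding piecewise_on_def by auto
  from bchoice[OF Q(4)] obtain b
    where b: "\<And>X. X \<in> \<Q> \<Longrightarrow> affine_map (b X)" "\<And>X x. X \<in> \<Q> \<Longrightarrow> x \<in> X \<Longrightarrow> g x = b X x"
    by auto
  let ?R = "(\<lambda>(X, Y). {x. x \<in> X \<and> a X x \<in> Y}) ` (\<P> \<times> \<Q>)"
  have "polyhedron Z" if "Z \<in> ?R" for Z
  proof -
    obtain X Y where XY: "X \<in> \<P>" "Y \<in> \<Q>" "Z = {x. x \<in> X \<and> a X x \<in> Y}" using \<open>Z \<in> ?R\<close> by auto
    have "polyhedral_set X" "polyhedral_set Y"
      using XY P(3) Q(2) by (auto simp: polyhedral_set_iff_polyhedron)
    then have "polyhedral_set (X \<inter> {x. a X x \<in> Y})"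
      using a(1)[OF XY(1)] by (intro polyhedral_set_Int polyhedral_set_vimage)
    then have "polyhedral_set Z"
      unfolding XY(3) by (simp add: Int_def)
    then show ?thesis by (simp add: polyhedral_set_iff_polyhedron)
  qed
  moreover have "D = \<Union>?R"
  proof (intro equalityI subsetI)
    fix x assume "x \<in> D"
    then obtain X where X: "X \<in> \<P>" "x \<in> X" using P(4) by auto
    moreover have "f x \<in> E" using assms(3) \<open>x \<in> D\<close> by simp
    then obtain Y where "Y \<in> \<Q>" "f x \<in> Y" using Q(3) by auto
    ultimately show "x \<in> \<Union>?R" using a(2)[OF X]
      by (intro UnionI[of "{x. x \<in> X \<and> a X x \<in> Y}"]) auto
  qed (use P(4) in auto)
  moreover have "\<exists>h. affine_map h \<and> (\<forall>x\<in>Z. g (f x) = h x)" if "Z \<in> ?R" for Z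
  proof -
    obtain X Y where XY: "X \<in> \<P>" "Y \<in> \<Q>" "Z = {x. x \<in> X \<and> a X x \<in> Y}" using \<open>Z \<in> ?R\<close> by auto
    then show ?thesis using a b affine_map_compose[OF b(1) a(1)]
      by (intro exI[of _ "\<lambda>x. b Y (a X x)"]) auto
  qed
  ultimately show ?thesis unfolding piecewise_on_def using P(1,2) Q(1)
    by (intro conjI exI[of _ ?R]) auto
qed

lemma continuous_on_affine_map:
  fixes g :: "'a::euclidean_space \<Rightarrow> 'b::real_normed_vector"
  assumes "affine_map g"
  shows "continuous_on S g"
proof -
  obtain L b where "linear L" "g = (\<lambda>x. L x + b)" using assms unfolding affine_map_def by auto
  then show ?thesis
    by (simp add: linear_conv_bounded_linear linear_continuous_on continuous_on_add)
qed

lemma affine_map_apply: "affine_map g \<Longrightarrow> affine_map (\<lambda>x. g x k)"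
  by (rule affine_map_linear_compose[of "\<lambda>f. f k"]) (auto simp: linear_iff scaleR_fun_def)

text \<open>Sequences carry the product topology rather than a norm, so continuity is checked entry
  by entry.\<close>

lemma continuous_on_affine_map_fun:
  fixes g :: "'a::euclidean_space \<Rightarrow> 'k \<Rightarrow> 'b::real_normed_vector"
  assumes "affine_map g"
  shows "continuous_on S g"
  by (rule continuous_on_coordinatewise_then_product)
    (rule continuous_on_affine_map[OF affine_map_apply[OF assms]])

lemma continuous_on_quadratic_map:
  fixes g :: "'a::euclidean_space \<Rightarrow> real"
  assumes "quadratic_map g"
  shows "continuous_on S g"
proof -
  obtain H L b where g: "bilinear H" "linear L" "g = (\<lambda>x. H x x + L x + b)"
    using assms unfolding quadratic_map_def by auto
  have "bounded_bilinear H" using g(1) by (simp add: bilinear_conv_bounded_bilinear)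
  then have "continuous_on S (\<lambda>x. H x x)"
    by (rule bounded_bilinear.continuous_on[OF _ continuous_on_id continuous_on_id])
  then show ?thesis unfolding g(3) using g(2)
    by (simp add: linear_conv_bounded_linear linear_continuous_on continuous_on_add)
qed

lemma quadratic_map_bilinear: "bilinear H \<Longrightarrow> quadratic_map (\<lambda>x. H x x)"
  unfolding quadratic_map_def
  by (intro exI[of _ H] exI[of _ "\<lambda>x. 0"] exI[of _ 0]) (auto intro: linearI)

lemma quadratic_map_bilinear_affine:
  assumes "bilinear H" "affine_map h"
  shows "quadratic_map (\<lambda>x. H (h x) (h x))"
proof -
  obtain L b where h: "linear L" "h = (\<lambda>x. L x + b)" using assms(2) unfolding affine_map_def by auto
  have l: "linear (H b)" "linear (\<lambda>x. H x b)" using assms(1) by (auto simp: bilinear_def)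
  have "bilinear (\<lambda>x y. H (L x) (L y))"
    using assms(1) h(1) unfolding bilinear_def linear_iff by auto
  moreover have "linear (\<lambda>x. H (L x) b + H b (L x))"
    using linear_compose[OF h(1) l(1)] linear_compose[OF h(1) l(2)]
    by (intro linear_compose_add) (auto simp: o_def)
  moreover have "H (h x) (h x) = H (L x) (L x) + (H (L x) b + H b (L x)) + H b b" for x
    by (simp add: h(2) bilinear_ladd[OF assms(1)] bilinear_radd[OF assms(1)])
  ultimately show ?thesis unfolding quadratic_map_def by blast
qed

section \<open>The optimal control problem\<close>

lemma pos_definite_sym: "pos_definite M \<Longrightarrow> x \<bullet> (M *v y) = y \<bullet> (M *v x)"
  unfolding pos_definite_def by (metis dot_lmul_matrix inner_commute transpose_matrix_vector)

lemma pos_definite_pos: "pos_definite M \<Longrightarrow> x \<noteq> 0 \<Longrightarrow> 0 < x \<bullet> (M *v x)"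
  by (simp add: pos_definite_def)

lemma pos_definite_nonneg: "pos_definite M \<Longrightarrow> 0 \<le> x \<bullet> (M *v x)"
  using pos_definite_pos[of M x] by (cases "x = 0") auto

lemma pos_definite_eq_0: "pos_definite M \<Longrightarrow> x \<bullet> (M *v x) = 0 \<longleftrightarrow> x = 0"
  using pos_definite_pos[of M x] by (cases "x = 0") auto

lemma pos_definite_closed_loop:
  assumes "pos_definite Q" "pos_definite R"
  shows "pos_definite (Q + transpose K ** R ** K :: real^'n^'n)"
proof -
  have "x \<bullet> ((transpose K ** R ** K) *v x) = (K *v x) \<bullet> (R *v (K *v x))" for x
  proof -
    have "x \<bullet> ((transpose K ** R ** K) *v x) = x \<bullet> ((R *v (K *v x)) v* K)"
      by (simp add: transpose_matrix_vector flip: matrix_vector_mul_assoc)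
    also have "\<dots> = (R *v (K *v x)) \<bullet> (K *v x)" by (simp add: inner_commute[of x] dot_lmul_matrix)
    finally show ?thesis by (simp add: inner_commute)
  qed
  then have "x \<bullet> ((Q + transpose K ** R ** K) *v x) > 0" if "x \<noteq> 0" for x
    using pos_definite_pos[OF assms(1) that] pos_definite_nonneg[OF assms(2), of "K *v x"]
    by (simp add: matrix_vector_mult_add_rdistrib inner_add_right)
  moreover have "transpose (Q + transpose K ** R ** K) = transpose Q + transpose K ** transpose R ** K"
  proof -
    have "transpose (M + M') = transpose M + transpose M'" for M M' :: "real^'n^'n"
      by (simp add: transpose_def vec_eq_iff)
    then show ?thesis by (simp add: matrix_transpose_mul matrix_mul_assoc)
  qed
  ultimately show ?thesis using assms by (simp add: pos_definite_def)
qed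

text \<open>The polar form of \<open>cost\<close>, needed to view the cost as an instance of
  \<open>psd_form\<close>.\<close>

fun cost_form ::
    "real^'n^'n \<Rightarrow> real^'m^'m \<Rightarrow> real^'n^'n \<Rightarrow> real^'n^'n \<Rightarrow> nat \<Rightarrow> nat
     \<Rightarrow> ('n::finite, 'm::finite) decision \<Rightarrow> ('n, 'm) decision \<Rightarrow> real" where
  "cost_form Q R QZ P N NZ (z, v, zf, \<omega>) (z', v', zf', \<omega>') =
     (\<Sum>k<N. z k \<bullet> (Q *v z' k) + v k \<bullet> (R *v v' k)) +
     (\<Sum>k=N..<N + NZ. zf k \<bullet> (QZ *v zf' k)) +
     zf (N + NZ) \<bullet> (P *v zf' (N + NZ))"

lemma cost_eq_cost_form: "cost Q R QZ P N NZ d = cost_form Q R QZ P N NZ d d"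
  by (cases d) (simp add: cost_def)

lemma bilinear_cost_form: "bilinear (cost_form Q R QZ P N NZ)"
  unfolding bilinear_def linear_iff
  by (auto simp: scaleR_fun_def inner_add_left inner_add_right matrix_vector_right_distrib
      sum.distrib sum_distrib_left distrib_left matrix_vector_mult_scaleR)

context
  fixes Q QZ P :: "real^'n^'n" and R :: "real^'m^'m"
  assumes pd: "pos_definite Q" "pos_definite R" "pos_definite QZ" "pos_definite P"
begin

lemma cost_form_sym: "cost_form Q R QZ P N NZ d d' = cost_form Q R QZ P N NZ d' d"
proof -
  obtain z v zf \<omega> z' v' zf' \<omega>' where "d = (z, v, zf, \<omega>)" "d' = (z', v', zf', \<omega>')"
    by (metis prod_cases4)
  then show ?thesis
    by (simp add: pos_definite_sym[OF pd(1), of "z _"] pos_definite_sym[OF pd(2), of "v _"]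
      pos_definite_sym[OF pd(3), of "zf _"] pos_definite_sym[OF pd(4), of "zf _"])
qed

lemma cost_form_nonneg: "cost_form Q R QZ P N NZ d d \<ge> 0"
  by (cases d) (auto intro!: add_nonneg_nonneg sum_nonneg pd[THEN pos_definite_nonneg])

text \<open>Every weighted entry vanishes, being part of a vanishing sum of nonnegative terms; the
  last one, \<open>zf (N + NZ)\<close>, is weighted by \<open>P\<close>. Entries outside the index
  ranges vanish by membership in the decision space.\<close>

lemma cost_form_eq_0:
  assumes "cost_form Q R QZ P N NZ (z, v, zf, \<omega>) (z, v, zf, \<omega>) = 0"
    and "(z, v, zf, \<omega>) \<in> decision_space N NS NZ"
  shows "z = 0" "v = 0" "zf = 0"
proof -
  note nonneg = pd[THEN pos_definite_nonneg]
  let ?s1 = "\<Sum>k<N. z k \<bullet> (Q *v z k) + v k \<bullet> (R *v v k)"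
  let ?s2 = "\<Sum>k=N..<N + NZ. zf k \<bullet> (QZ *v zf k)"
  let ?s3 = "zf (N + NZ) \<bullet> (P *v zf (N + NZ))"
  have "?s1 \<ge> 0" "?s2 \<ge> 0" "?s3 \<ge> 0" using nonneg by (auto intro!: sum_nonneg add_nonneg_nonneg)
  moreover have "?s1 + ?s2 + ?s3 = 0" using assms(1) by simp
  ultimately have s: "?s1 = 0" "?s2 = 0" "?s3 = 0" by linarith+
  have "z k \<bullet> (Q *v z k) + v k \<bullet> (R *v v k) = 0" if "k < N" for k
    using s(1) nonneg that by (subst (asm) sum_nonneg_eq_0_iff) (auto intro!: add_nonneg_nonneg)
  then have zv: "z k \<bullet> (Q *v z k) = 0 \<and> v k \<bullet> (R *v v k) = 0" if "k < N" for k
    using that nonneg by (simp add: add_nonneg_eq_0_iff)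
  have "zf k \<bullet> (QZ *v zf k) = 0" if "N \<le> k" "k < N + NZ" for k
    using s(2) nonneg that by (subst (asm) sum_nonneg_eq_0_iff) auto
  then have zf: "zf k = 0" if "N \<le> k" "k \<le> N + NZ" for k
    using s(3) pd that by (cases "k = N + NZ") (auto simp: pos_definite_eq_0)
  have "z k = 0" "v k = 0" "zf k = 0" for k
    using zv[of k] zf[of k] assms(2) pd
    by (cases "k < N"; auto simp: decision_space_def supported_on_def pos_definite_eq_0)+
  then show "z = 0" "v = 0" "zf = 0" by auto
qed

end

section \<open>The constraints as polyhedral systems\<close>

lemma finitely_spanned_supported_on:
  "finite I \<Longrightarrow> finitely_spanned {f :: nat \<Rightarrow> 'e::euclidean_space. supported_on I f}"
  unfolding supported_on_def by (rule finitely_spanned_finite_support)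

lemma finitely_spanned_decision_space:
  "finitely_spanned (decision_space N NS NZ :: ('n::finite, 'm::finite) decision set)"
proof -
  have "decision_space N NS NZ =
      {z :: nat \<Rightarrow> real^'n. supported_on {..<N} z} \<times> {v :: nat \<Rightarrow> real^'m. supported_on {..<N} v} \<times>
      {zf :: nat \<Rightarrow> real^'n. supported_on {N..N + NZ} zf} \<times> {\<omega> :: nat \<Rightarrow> real^'n. supported_on {..<NS} \<omega>}"
    by (auto simp: decision_space_def)
  then show ?thesis by (simp add: finitely_spanned_Times finitely_spanned_supported_on)
qed

text \<open>The constraints on \<open>\<omega>\<close>, with \<open>s\<close> in place of the
  remainder \<open>x - z 0\<close>. Bounded quantifiers over finite sets fit
  \<open>polyhedral_set_ball\<close>.\<close>

definition tube_system ::
    "real^'n^'n \<Rightarrow> real \<Rightarrow> nat \<Rightarrow> (nat \<Rightarrow> real^'n) \<Rightarrow> nat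
     \<Rightarrow> ((real^'n) \<times> (nat \<Rightarrow> real^'n)) set" where
  "tube_system M \<alpha> q e NS = {(s, \<omega>).
     s = (1 / (1 - \<alpha>)) *\<^sub>R (\<Sum>j<NS. matpow M j *v \<omega> j) \<and>
     (\<forall>j\<in>{..<NS}. \<forall>i\<in>{1..q}. e i \<bullet> \<omega> j \<le> 1)}"

lemma polyhedral_tube_system:
  fixes M :: "real^'n^'n"
  shows "polyhedral_set (tube_system M \<alpha> q e NS)"
proof -
  have "linear (\<lambda>p::(real^'n) \<times> (nat \<Rightarrow> real^'n). (1 / (1 - \<alpha>)) *\<^sub>R (\<Sum>j<NS. matpow M j *v snd p j))"
    by (auto simp: linear_iff scaleR_fun_def matrix_vector_right_distrib sum.distrib
        scaleR_add_right matrix_vector_mult_scaleR simp flip: scaleR_sum_right)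
  moreover have "linear (\<lambda>p::(real^'n) \<times> (nat \<Rightarrow> real^'n). e i \<bullet> snd p j)" for i j
    by (auto simp: linear_iff scaleR_fun_def inner_add_right)
  ultimately show ?thesis
    unfolding tube_system_def case_prod_unfold
    by (intro polyhedral_set_conj polyhedral_set_ball polyhedral_set_le polyhedral_set_eq
        affine_map_const affine_map_linear linear_fst) auto
qed

definition nominal_system ::
    "real^'n^'n \<Rightarrow> real^'m^'n \<Rightarrow> real^'n^'m \<Rightarrow> nat \<Rightarrow> (nat \<Rightarrow> real^'n) \<Rightarrow> (nat \<Rightarrow> real^'m)
     \<Rightarrow> (nat \<Rightarrow> real) \<Rightarrow> nat \<Rightarrow> nat \<Rightarrow> ((nat \<Rightarrow> real^'n) \<times> (nat \<Rightarrow> real^'m)) set" where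
  "nominal_system A B KZ p c d f N NZ = {(y, v).
     (\<forall>k\<in>{..<N}. y (k + 1) = A *v y k + B *v v k) \<and>
     (\<forall>k\<in>{..<N}. \<forall>i\<in>{1..p}. c i \<bullet> y k + d i \<bullet> v k \<le> 1 - f i) \<and>
     (\<forall>k\<in>{..<NZ}. y (N + k + 1) = (A + B ** KZ) *v y (N + k)) \<and>
     (\<forall>k\<in>{..NZ}. \<forall>i\<in>{1..p}. (c i + d i v* KZ) \<bullet> y (N + k) \<le> 1 - f i)}"

lemma polyhedral_nominal_system:
  fixes A :: "real^'n^'n" and B :: "real^'m^'n"
  shows "polyhedral_set (nominal_system A B KZ p c d f N NZ)"
proof -
  note lin = linear_iff scaleR_fun_def matrix_vector_right_distrib inner_add_right
    matrix_vector_mult_scaleR algebra_simps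
  have "linear (\<lambda>p::(nat \<Rightarrow> real^'n) \<times> (nat \<Rightarrow> real^'m). fst p k)" "linear (\<lambda>p::(nat \<Rightarrow> real^'n) \<times> (nat \<Rightarrow> real^'m). A *v fst p k + B *v snd p k)"
    "linear (\<lambda>p::(nat \<Rightarrow> real^'n) \<times> (nat \<Rightarrow> real^'m). a \<bullet> fst p k + b \<bullet> snd p k)" "linear (\<lambda>p::(nat \<Rightarrow> real^'n) \<times> (nat \<Rightarrow> real^'m). M *v fst p k)"
    "linear (\<lambda>p::(nat \<Rightarrow> real^'n) \<times> (nat \<Rightarrow> real^'m). a \<bullet> fst p k)"
    for k a b and M :: "real^'n^'n"
    by (auto simp: lin)
  then show ?thesis
    unfolding nominal_system_def case_prod_unfold
    by (intro polyhedral_set_conj polyhedral_set_ball polyhedral_set_le polyhedral_set_eq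
        affine_map_const affine_map_linear) auto
qed

text \<open>\<open>x\<close> and \<open>\<omega>\<close> are tied to the nominal trajectory only
  through its initial state, so \<open>\<omega>\<close> can be exchanged for any other sequence that
  represents the same remainder.\<close>

lemma feasible_set_iff:
  "(z, v, zf, \<omega>) \<in> feasible_set A B KS KZ \<alpha> p c d f q e N NS NZ x \<longleftrightarrow>
    (z, v, zf, \<omega>) \<in> decision_space N NS NZ \<and>
    (joined N z zf, v) \<in> nominal_system A B KZ p c d f N NZ \<and>
    (x - joined N z zf 0, \<omega>) \<in> tube_system (A + B ** KS) \<alpha> q e NS"
  unfolding feasible_set_def nominal_system_def tube_system_def Let_def
  by (auto simp: algebra_simps)

lemma feasible_set_polyhedral:
  fixes A :: "real^'n^'n" and B :: "real^'m^'n"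
  shows "\<exists>M. polyhedral_set M \<and> (\<forall>x. feasible_set A B KS KZ \<alpha> p c d f q e N NS NZ x =
      {d \<in> decision_space N NS NZ. (x, d) \<in> M})"
proof (intro exI conjI allI)
  let ?M = "{t :: (real^'n) \<times> ('n, 'm) decision.
      (joined N (fst (snd t)) (fst (snd (snd (snd t)))), fst (snd (snd t)))
        \<in> nominal_system A B KZ p c d f N NZ \<and>
      (fst t - joined N (fst (snd t)) (fst (snd (snd (snd t)))) 0, snd (snd (snd (snd t))))
        \<in> tube_system (A + B ** KS) \<alpha> q e NS}"
  have "linear (\<lambda>t :: (real^'n) \<times> ('n, 'm) decision.
      (joined N (fst (snd t)) (fst (snd (snd (snd t)))), fst (snd (snd t))))"
    by (auto simp: linear_iff joined_def fun_eq_iff scaleR_fun_def)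
  moreover have "linear (\<lambda>t :: (real^'n) \<times> ('n, 'm) decision.
      (fst t - joined N (fst (snd t)) (fst (snd (snd (snd t)))) 0, snd (snd (snd (snd t)))))"
    by (auto simp: linear_iff joined_def fun_eq_iff scaleR_fun_def algebra_simps)
  ultimately show "polyhedral_set ?M"
    by (intro polyhedral_set_conj polyhedral_set_vimage polyhedral_nominal_system
        polyhedral_tube_system affine_map_linear)
  show "feasible_set A B KS KZ \<alpha> p c d f q e N NS NZ x =
      {d \<in> decision_space N NS NZ. (x, d) \<in> ?M}" for x
    by (auto simp: feasible_set_iff)
qed

text \<open>The disturbance sequence of least norm is a continuous choice, being the solution of
  another quadratic program with parameter \<open>s\<close>.\<close>

lemma tube_selection:
  fixes S :: "(real^'n) set"
  assumes S: "S = {s. \<exists>\<omega>. supported_on {..<NS} \<omega> \<and> (s, \<omega>) \<in> tube_system M \<alpha> q e NS}"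
  obtains w where "piecewise_affine_on S w"
    "\<And>s. s \<in> S \<Longrightarrow> supported_on {..<NS} (w s) \<and> (s, w s) \<in> tube_system M \<alpha> q e NS"
proof -
  define H :: "(nat \<Rightarrow> real^'n) \<Rightarrow> (nat \<Rightarrow> real^'n) \<Rightarrow> real" where "H a b = (\<Sum>j<NS. a j \<bullet> b j)" for a b
  define F where "F s = {\<omega> \<in> {\<omega>. supported_on {..<NS} \<omega>}. (s, \<omega>) \<in> tube_system M \<alpha> q e NS}" for s
  have H: "bilinear H" "H a b = H b a" "H a a \<ge> 0" for a b
    by (auto simp: H_def bilinear_def linear_iff scaleR_fun_def inner_add_left inner_add_right
        sum.distrib sum_distrib_left inner_commute intro!: sum_nonneg)
  have definite: "a = 0" if "a \<in> {\<omega>. supported_on {..<NS} \<omega>}" "H a a = 0" for a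
    using that by (fastforce simp: H_def supported_on_def fun_eq_iff sum_nonneg_eq_0_iff)
  have D: "S = {s. F s \<noteq> {}}" by (auto simp: S F_def)
  \<comment> \<open>This form is definite on sequences supported in the range, so the component
    \<open>\<pi>\<close> can be the identity.\<close>
  note qp = parametric_qp_minimizers[OF H finitely_spanned_supported_on[OF finite_lessThan]
      polyhedral_tube_system linear_id[unfolded id_def] definite F_def D]
  obtain w where w: "\<forall>s. \<forall>\<omega>\<in>minimizers (\<lambda>a. H a a) (F s). \<omega> = w s" "piecewise_affine_on S w"
    using qp(2) by auto
  have "w s \<in> F s" if s: "s \<in> S" for s
  proof -
    obtain \<omega> where "\<omega> \<in> minimizers (\<lambda>a. H a a) (F s)" using bspec[OF qp(1) s] by blast
    moreover from this have "\<omega> \<in> F s" by (simp add: minimizers_def is_arg_min_def)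
    ultimately show ?thesis using w(1)[rule_format, of \<omega> s] by simp
  qed
  then show thesis using w(2) that by (simp add: F_def)
qed

text \<open>Makes \<open>S\<close> the domain of the program in \<open>tube_selection\<close>: a
  point of the Minkowski sum comes with one \<open>u j\<close> in \<open>W\<close> per summand, and
  these are padded by zeros to a supported sequence.\<close>

lemma tube_set_eq:
  assumes W: "W = (\<Inter>i\<in>{1..q}. {w. e i \<bullet> w \<le> 1})"
    and S: "S = (*\<^sub>R) (1 / (1 - \<alpha>)) ` (\<Sum>j<NS. (*v) (matpow M j) ` W)"
  shows "S = {s. \<exists>\<omega>. supported_on {..<NS} \<omega> \<and> (s, \<omega>) \<in> tube_system M \<alpha> q e NS}"
proof (intro equalityI subsetI)
  fix x assume "x \<in> S"
  then obtain s where s: "x = (1 / (1 - \<alpha>)) *\<^sub>R sum s {..<NS}" "\<forall>j\<in>{..<NS}. s j \<in> (*v) (matpow M j) ` W"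
    unfolding S set_sum_alt[OF finite_lessThan] by auto
  from s(2) have "\<forall>j\<in>{..<NS}. \<exists>w\<in>W. s j = matpow M j *v w" by blast
  from bchoice[OF this[unfolded Bex_def]] obtain u
    where u: "\<forall>j\<in>{..<NS}. u j \<in> W \<and> s j = matpow M j *v u j" by auto
  let ?\<omega> = "\<lambda>j. if j < NS then u j else 0"
  have "supported_on {..<NS} ?\<omega> \<and> (x, ?\<omega>) \<in> tube_system M \<alpha> q e NS"
    using u s(1) by (auto simp: supported_on_def tube_system_def W)
  then show "x \<in> {s. \<exists>\<omega>. supported_on {..<NS} \<omega> \<and> (s, \<omega>) \<in> tube_system M \<alpha> q e NS}" by blast
next
  fix x assume "x \<in> {s. \<exists>\<omega>. supported_on {..<NS} \<omega> \<and> (s, \<omega>) \<in> tube_system M \<alpha> q e NS}"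
  then obtain \<omega> where "(x, \<omega>) \<in> tube_system M \<alpha> q e NS" by blast
  then have \<omega>: "x = (1 / (1 - \<alpha>)) *\<^sub>R (\<Sum>j<NS. matpow M j *v \<omega> j)" "\<forall>j\<in>{..<NS}. \<omega> j \<in> W"
    by (auto simp: tube_system_def W)
  then have "(\<Sum>j<NS. matpow M j *v \<omega> j) \<in> (\<Sum>j<NS. (*v) (matpow M j) ` W)"
    unfolding set_sum_alt[OF finite_lessThan] by auto
  with \<omega>(1) show "x \<in> S" unfolding S by blast
qed

lemma optimal_value_minimizer:
  assumes "d \<in> minimizers J F"
  shows "optimal_value J F = ereal (J d)"
proof -
  from assms have "d \<in> F" "\<And>d'. d' \<in> F \<Longrightarrow> J d \<le> J d'"
    unfolding minimizers_def is_arg_min_def by (auto simp: not_less)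
  then show ?thesis unfolding optimal_value_def by (intro antisym INF_lower INF_greatest) auto
qed

theorem theorem1:
  fixes A Q P :: "real^'n^'n" and B :: "real^'m^'n" and R :: "real^'m^'m"
    and KS KZ :: "real^'n^'m"
    and p q :: nat
    and c e :: "nat \<Rightarrow> real^'n" and d :: "nat \<Rightarrow> real^'m" and f :: "nat \<Rightarrow> real"
    and \<alpha> :: real and N NS NZ :: nat
    and Y YS :: "((real^'n) \<times> (real^'m)) set"
    and W S ZS CT :: "(real^'n) set"
    and Zf :: "nat \<Rightarrow> (real^'n) set"
    and QZ :: "real^'n^'n"
    and D :: "('n, 'm) decision set"
    and VT :: "('n, 'm) decision \<Rightarrow> real"
    and feas opt :: "real^'n \<Rightarrow> ('n, 'm) decision set"
    and V0 :: "real^'n \<Rightarrow> ereal"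
  assumes stabilizable: "strictly_stabilizable A B"
    and Y_eq: "Y = (\<Inter>i\<in>{1..p}. {(x, u). c i \<bullet> x + d i \<bullet> u \<le> 1})"
    and Y: "polyhedron Y" "proper_D_set Y"
    and Y_irred: "irreducible_representation {1..p} (\<lambda>i. {(x, u). c i \<bullet> x + d i \<bullet> u \<le> 1})"
    and W_eq: "W = (\<Inter>i\<in>{1..q}. {w. e i \<bullet> w \<le> 1})"
    and W: "polyhedron W" "proper_C_set W"
    and W_irred: "irreducible_representation {1..q} (\<lambda>i. {w. e i \<bullet> w \<le> 1})"
    and QR: "pos_definite Q" "pos_definite R"
    and KS: "strictly_stable (A + B ** KS)"
    and \<alpha>: "0 \<le> \<alpha>" "\<alpha> < 1"
    and NS: "(*v) (matpow (A + B ** KS) NS) ` W \<subseteq> (*\<^sub>R) \<alpha> ` W"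
    and S_eq: "S = (*\<^sub>R) (1 / (1 - \<alpha>)) ` (\<Sum>j<NS. (*v) (matpow (A + B ** KS) j) ` W)"
    and f_eq: "\<And>i. i \<in> {1..p} \<Longrightarrow> f i = support_fun S (c i + transpose KS *v d i)"
    and f_less: "\<And>i. i \<in> {1..p} \<Longrightarrow> f i < 1"
    and YS_eq: "YS = {(z, v). \<forall>s\<in>S. (z + s, v + KS *v s) \<in> Y}"
    and KZ: "strictly_stable (A + B ** KZ)"
    and ZS_eq: "ZS = {z. (z, KZ *v z) \<in> YS}"
    and Zf_eq: "\<And>M. Zf M = (\<Inter>j\<in>{0..M}. (*v) (matpow (A + B ** KZ) j) -` ZS)"
    and NZ: "Zf NZ \<subseteq> (*v) (matpow (A + B ** KZ) (NZ + 1)) -` ZS"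
    and QZ_eq: "QZ = Q + transpose KZ ** R ** KZ"
    and P: "pos_definite P"
      "loewner_le (transpose (A + B ** KZ) ** P ** (A + B ** KZ) - P) (- QZ)"
    and N: "N \<ge> 1"
    and D_eq: "D = decision_space N NS NZ"
    and VT_eq: "VT = cost Q R QZ P N NZ"
    and feas_eq: "feas = feasible_set A B KS KZ \<alpha> p c d f q e N NS NZ"
    and CT_eq: "CT = {x. feas x \<noteq> {}}"
    and V0_eq: "V0 = (\<lambda>x. optimal_value VT (feas x))"
    and opt_eq: "opt = (\<lambda>x. minimizers VT (feas x))"
  shows
    "(\<forall>x. convex_quadratic_program D VT (feas x)) \<and> (\<forall>x\<in>CT. feas x \<noteq> {}) \<and>
     (\<exists>V :: real^'n \<Rightarrow> real. (\<forall>x\<in>CT. V0 x = ereal (V x)) \<and>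
        convex_on CT V \<and> continuous_on CT V \<and> piecewise_quadratic_on CT V) \<and>
     (\<forall>x\<in>S. V0 x = 0) \<and> (\<forall>x\<in>CT - S. 0 < V0 x \<and> V0 x < \<infinity>) \<and>
     (\<exists>z0 v0 zf0.
        (\<forall>x\<in>CT. (\<lambda>(z, v, zf, \<omega>). z) ` opt x = {z0 x} \<and>
                (\<lambda>(z, v, zf, \<omega>). v) ` opt x = {v0 x} \<and>
                (\<lambda>(z, v, zf, \<omega>). zf) ` opt x = {zf0 x}) \<and>
        continuous_on CT z0 \<and> piecewise_affine_on CT z0 \<and>
        continuous_on CT v0 \<and> piecewise_affine_on CT v0 \<and>
        continuous_on CT zf0 \<and> piecewise_affine_on CT zf0 \<and>
        (\<exists>\<omega>s. continuous_on CT \<omega>s \<and> piecewise_affine_on CT \<omega>s \<and>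
           (\<forall>x\<in>CT. (z0 x, v0 x, zf0 x, \<omega>s x) \<in> opt x)))"
proof -
  define H where "H = (cost_form Q R QZ P N NZ :: ('n, 'm) decision \<Rightarrow> _)"
  \<comment> \<open>Erasing \<open>\<omega>\<close> instead of dropping it keeps the type of
    decisions, so that \<open>H\<close> applies to \<open>\<pi> d\<close> and the optimal value
    becomes \<open>H (h x) (h x)\<close>.\<close>
  define \<pi> :: "('n, 'm) decision \<Rightarrow> ('n, 'm) decision"
    where "\<pi> d = (fst d, fst (snd d), fst (snd (snd d)), 0)" for d
  have pd: "pos_definite Q" "pos_definite R" "pos_definite QZ" "pos_definite P"
    using QR P(1) by (auto simp: QZ_eq pos_definite_closed_loop)
  have VT: "VT = (\<lambda>d. H d d)" by (simp add: VT_eq H_def cost_eq_cost_form fun_eq_iff)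
  have H: "bilinear H" "H d d' = H d' d" "H d d \<ge> 0" for d d'
    unfolding H_def
    by (rule bilinear_cost_form cost_form_sym[OF pd] cost_form_nonneg[OF pd])+
  interpret psd_form H by unfold_locales (rule H)+
  have H_pi: "H (\<pi> d) (\<pi> d) = H d d" for d by (cases d) (simp add: H_def \<pi>_def)
  have kernel: "\<pi> d = 0" if "d \<in> D" "H d d = 0" for d
    using cost_form_eq_0[OF pd, of N NZ "fst d" "fst (snd d)" "fst (snd (snd d))" "snd (snd (snd d))" NS]
      that by (simp add: H_def D_eq \<pi>_def zero_prod_def)
  have linear_pi: "linear \<pi>" by (auto simp: \<pi>_def linear_iff)
  obtain M where M: "polyhedral_set M" "\<And>x. feas x = {d \<in> D. (x, d) \<in> M}"
    using feasible_set_polyhedral[of A B KS KZ \<alpha> p c d f q e N NS NZ]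
    unfolding feas_eq[symmetric] D_eq[symmetric] by fast
  have D: "finitely_spanned D" unfolding D_eq by (rule finitely_spanned_decision_space)
  have S_tube: "S = {s. \<exists>\<omega>. supported_on {..<NS} \<omega> \<and> (s, \<omega>) \<in> tube_system (A + B ** KS) \<alpha> q e NS}"
    by (rule tube_set_eq[OF W_eq S_eq])
  \<comment> \<open>\<open>N \<ge> 1\<close> places index 0 in the first block: the initial state is
    \<open>z 0\<close> and not \<open>zf 0\<close>.\<close>
  have feas: "(z, v, zf, \<omega>) \<in> feas x \<longleftrightarrow> (z, v, zf, \<omega>) \<in> D \<and>
      (joined N z zf, v) \<in> nominal_system A B KZ p c d f N NZ \<and>
      (x - z 0, \<omega>) \<in> tube_system (A + B ** KS) \<alpha> q e NS" for x z v zf \<omega>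
    using N by (simp add: feas_eq D_eq feasible_set_iff joined_def)
  note qp = parametric_qp_minimizers[OF H D M(1) linear_pi kernel M(2) CT_eq, folded VT]
  have opt_ne: "\<exists>d. d \<in> opt x" if "x \<in> CT" for x
    using bspec[OF qp(1) that] by (auto simp: opt_eq)
  obtain h where h: "\<And>x d. d \<in> opt x \<Longrightarrow> \<pi> d = h x" and h_pw: "piecewise_affine_on CT h"
    using qp(2) unfolding opt_eq by auto
  define V where "V x = H (h x) (h x)" for x
  have V: "V x = VT d" if "d \<in> opt x" for x d
    using h[OF that] H_pi[of d] by (simp add: V_def VT)
  have V0: "V0 x = ereal (V x)" if "x \<in> CT" for x
    using opt_ne[OF that] optimal_value_minimizer[of _ VT "feas x"] V by (auto simp: V0_eq opt_eq)
  have opt_feas: "d \<in> feas x" if "d \<in> opt x" for x d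
    using that by (simp add: opt_eq minimizers_def is_arg_min_def)

  have program: "convex_quadratic_program D VT (feas x)" for x
  proof -
    have "affine_map (\<lambda>d :: ('n, 'm) decision. (x, d))"
      unfolding affine_map_def
      by (intro exI[of _ "\<lambda>d. (0, d)"] exI[of _ "(x, 0)"]) (auto simp: linear_iff)
    then have "polyhedral_set {d. (x, d) \<in> M}" by (rule polyhedral_set_vimage[OF M(1)])
    then obtain G where G: "finite G" "\<forall>g\<in>G. affine_map g" "{d. (x, d) \<in> M} = {d. \<forall>g\<in>G. g d \<le> (0::real)}"
      unfolding polyhedral_set_def by auto
    have "convex_on D VT"
      unfolding convex_on_def VT
      using subspace_imp_convex[OF finitely_spanned_subspace[OF D]] H_convex by blast
    moreover have "feas x = {d \<in> D. \<forall>g\<in>G. g d \<le> 0}" using G(3) M(2)[of x] by blast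
    ultimately show ?thesis
      unfolding convex_quadratic_program_def
      using D finitely_spanned_subspace[OF D] quadratic_map_bilinear[OF H(1)] G(1,2)
      by (auto simp: finitely_spanned_def VT)
  qed

  have convex: "convex_on CT V"
  proof (rule qp(3))
    fix x d assume "d \<in> minimizers VT (feas x)"
    then have "d \<in> opt x" by (simp add: opt_eq)
    from V[OF this] show "V x = H d d" by (simp add: VT)
  qed
  have quadratic: "piecewise_quadratic_on CT V"
    unfolding V_def
    by (rule piecewise_on_transform[OF h_pw]) (rule quadratic_map_bilinear_affine[OF H(1)])
  have continuous: "continuous_on CT V"
    using quadratic continuous_on_quadratic_map by (rule continuous_on_piecewise)

  have V0_S: "V0 x = 0" if x: "x \<in> S" for x
  proof -
    obtain \<omega> where \<omega>: "supported_on {..<NS} \<omega>" "(x, \<omega>) \<in> tube_system (A + B ** KS) \<alpha> q e NS"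
      using x S_tube by auto
    \<comment> \<open>The origin satisfies the tightened constraints, so the zero nominal trajectory
      is feasible, and its cost 0 is a lower bound for all costs.\<close>
    have "0 \<le> 1 - f i" if "i \<in> {1..p}" for i using f_less[OF that] by simp
    then have "(0, 0, 0, \<omega>) \<in> feas x"
      using \<omega> by (auto simp: feas D_eq decision_space_def supported_on_def nominal_system_def joined_def)
    moreover have "VT (0, 0, 0, \<omega>) = 0" by (simp add: VT H_def)
    ultimately have "(0, 0, 0, \<omega>) \<in> minimizers VT (feas x)"
      using H(3) by (auto simp: minimizers_def is_arg_min_def VT not_less)
    from optimal_value_minimizer[OF this] show ?thesis
      using \<open>VT (0, 0, 0, \<omega>) = 0\<close> by (simp add: V0_eq)
  qed
  have V0_pos: "0 < V0 x \<and> V0 x < \<infinity>" if x: "x \<in> CT - S" for x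
  proof -
    obtain z v zf \<omega> where d: "(z, v, zf, \<omega>) \<in> opt x" using opt_ne[of x] x by auto
    \<comment> \<open>Zero cost forces \<open>z = 0\<close>; then \<open>x\<close> itself is the
      remainder represented by \<open>\<omega>\<close> and lies in \<open>S\<close>.\<close>
    have "V x \<noteq> 0"
    proof
      assume "V x = 0"
      then have "\<pi> (z, v, zf, \<omega>) = 0"
        using V[OF d] opt_feas[OF d] by (intro kernel) (auto simp: VT feas)
      then have "z = 0" by (simp add: \<pi>_def zero_prod_def)
      then have "x \<in> S"
        using opt_feas[OF d] by (auto simp: feas S_tube D_eq decision_space_def)
      then show False using x by simp
    qed
    moreover have "V x \<ge> 0" by (simp add: V_def H(3))
    ultimately show ?thesis using V0 x by simp
  qed

  define z0 v0 zf0 where "z0 x = fst (h x)" and "v0 x = fst (snd (h x))"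
    and "zf0 x = fst (snd (snd (h x)))" for x
  have comp: "z = z0 x" "v = v0 x" "zf = zf0 x" if "(z, v, zf, \<omega>) \<in> opt x" for x z v zf \<omega>
    unfolding z0_def v0_def zf0_def h[OF that, symmetric] by (auto simp: \<pi>_def)
  have image: "g ` opt x = {a}" if x: "x \<in> CT" and g: "\<And>d. d \<in> opt x \<Longrightarrow> g d = a"
    for g :: "('n, 'm) decision \<Rightarrow> 'k" and a x
  proof -
    obtain d where d: "d \<in> opt x" using opt_ne[OF x] by auto
    have "g ` opt x = (\<lambda>d. a) ` opt x" by (rule image_cong[OF refl g])
    then show ?thesis unfolding image_constant[OF d] .
  qed
  have single: "(\<lambda>(z, v, zf, \<omega>). z) ` opt x = {z0 x}" "(\<lambda>(z, v, zf, \<omega>). v) ` opt x = {v0 x}"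
    "(\<lambda>(z, v, zf, \<omega>). zf) ` opt x = {zf0 x}" if x: "x \<in> CT" for x
    by (rule image[OF x]; auto intro: comp)+
  have pw: "piecewise_affine_on CT z0" "piecewise_affine_on CT v0" "piecewise_affine_on CT zf0"
    unfolding z0_def v0_def zf0_def
    using piecewise_on_transform[OF h_pw, of affine_map "\<lambda>x. fst"]
      piecewise_on_transform[OF h_pw, of affine_map "\<lambda>x d. fst (snd d)"]
      piecewise_on_transform[OF h_pw, of affine_map "\<lambda>x d. fst (snd (snd d))"]
    by (simp_all add: affine_map_linear_compose[OF linear_fst] affine_map_linear_compose[OF linear_snd])
  have cont: "continuous_on CT g" if "piecewise_affine_on CT g"
    for g :: "real^'n \<Rightarrow> nat \<Rightarrow> real^'k"
    using that continuous_on_affine_map_fun by (rule continuous_on_piecewise)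

  obtain w where w: "piecewise_affine_on S w"
    "\<And>s. s \<in> S \<Longrightarrow> supported_on {..<NS} (w s) \<and> (s, w s) \<in> tube_system (A + B ** KS) \<alpha> q e NS"
    using tube_selection[OF S_tube] by auto
  \<comment> \<open>The selection is evaluated at the remainder, which \<open>feas_s\<close> shows
    to lie in \<open>S\<close>, the domain on which \<open>w\<close> is piecewise affine.\<close>
  define \<omega>s where "\<omega>s x = w (x - z0 x 0)" for x
  have feas_s: "x - z0 x 0 \<in> S \<and> (z0 x, v0 x, zf0 x, \<omega>s x) \<in> opt x" if x: "x \<in> CT" for x
  proof -
    obtain z v zf \<omega> where d: "(z, v, zf, \<omega>) \<in> opt x" using opt_ne[OF x] by auto
    note eq = comp[OF d]
    have d': "(z0 x, v0 x, zf0 x, \<omega>) \<in> opt x" using d eq by simp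
    have s: "x - z0 x 0 \<in> S"
      using opt_feas[OF d'] by (auto simp: feas S_tube D_eq decision_space_def)
    have "(z0 x, v0 x, zf0 x, \<omega>s x) \<in> feas x"
      using opt_feas[OF d'] w(2)[OF s] by (auto simp: feas D_eq decision_space_def \<omega>s_def)
    \<comment> \<open>\<open>H\<close> ignores \<open>\<omega>\<close>, so the exchanged decision
      has the same cost and inherits optimality.\<close>
    moreover have "VT (z0 x, v0 x, zf0 x, \<omega>s x) = VT (z0 x, v0 x, zf0 x, \<omega>)"
      by (simp add: VT H_def)
    ultimately have "(z0 x, v0 x, zf0 x, \<omega>s x) \<in> opt x"
      using d' by (simp add: opt_eq minimizers_def is_arg_min_def)
    with s show ?thesis by simp
  qed
  have "piecewise_affine_on CT (\<lambda>x. x - z0 x 0)"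
    by (rule piecewise_on_transform[OF pw(1), of _ "\<lambda>x z. x - z 0"])
      (rule affine_map_diff[OF affine_map_linear[OF linear_id[unfolded id_def]] affine_map_apply])
  then have pw_s: "piecewise_affine_on CT \<omega>s"
    unfolding \<omega>s_def
    by (rule piecewise_affine_on_compose[OF _ w(1) conjunct1[OF feas_s]])
  have "\<exists>z0 v0 zf0.
        (\<forall>x\<in>CT. (\<lambda>(z, v, zf, \<omega>). z) ` opt x = {z0 x} \<and>
                (\<lambda>(z, v, zf, \<omega>). v) ` opt x = {v0 x} \<and>
                (\<lambda>(z, v, zf, \<omega>). zf) ` opt x = {zf0 x}) \<and>
        continuous_on CT z0 \<and> piecewise_affine_on CT z0 \<and>
        continuous_on CT v0 \<and> piecewise_affine_on CT v0 \<and>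
        continuous_on CT zf0 \<and> piecewise_affine_on CT zf0 \<and>
        (\<exists>\<omega>s. continuous_on CT \<omega>s \<and> piecewise_affine_on CT \<omega>s \<and>
           (\<forall>x\<in>CT. (z0 x, v0 x, zf0 x, \<omega>s x) \<in> opt x))"
    using single pw cont[OF pw(1)] cont[OF pw(2)] cont[OF pw(3)] pw_s cont[OF pw_s] feas_s
    by (intro exI[of _ z0] exI[of _ v0] exI[of _ zf0] exI[of _ \<omega>s] conjI ballI) simp_all
  moreover have "\<exists>V. (\<forall>x\<in>CT. V0 x = ereal (V x)) \<and>
      convex_on CT V \<and> continuous_on CT V \<and> piecewise_quadratic_on CT V"
    using V0 convex continuous quadratic by (intro exI[of _ V]) simp
  moreover have "\<forall>x\<in>CT. feas x \<noteq> {}" by (simp add: CT_eq)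
  ultimately show ?thesis
    using program V0_S V0_pos by (intro conjI ballI allI) simp_all
qed

end
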